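(* For $k_1,\ldots,k_r\in\mathbb{Z}_{\ge0}$ and all $(s_1,\ldots,s_r)\in\mathbb{C}^r$, \[\eta(-k_1,\ldots,-k_r;s_1,\ldots,s_r)=\mathbb{B}^{(s_1,\ldots,s_r)}_{k_1,\ldots,k_r}.\]
   Context: For $s_1,\ldots,s_r\in\mathbb{C}$, $\mathrm{Li}^{\sqcup\!\sqcup}_{s_1,\ldots,s_r}(z_1,\ldots,z_r)=\sum_{l_1,\ldots,l_r\ge1}\frac{z_1^{l_1}\cdots z_r^{l_r}}{l_1^{s_1}(l_1+l_2)^{s_2}\cdots(l_1+\cdots+l_r)^{s_r}}$ for $|z_j|<1$; for non-positive integer $s_j=-k_j$ this is a rational function of the $z_j$ with denominator $\prod_{j=1}^r(1-z_j)^{\sum_{\nu=j}^r k_\nu+1}$. With $T_j=\sum_{\nu=j}^r t_\nu$, for $\mathrm{Re}(s_j)>0$ define $\eta(-k_1,\ldots,-k_r;s_1,\ldots,s_r)=\frac{1}{\prod_j\Gamma(s_j)}\int_{(0,\infty)^r}\prod_j t_j^{s_j-1}\frac{\mathrm{Li}^{\sqcup\!\sqcup}_{-k_1,\ldots,-k_r}(1-e^{T_1},\ldots,1-e^{T_r})}{\prod_j(1-e^{T_j})}\prod_j dt_j$, analytically continued to an entire function on $\mathbb{C}^r$. With $X_j=\sum_{\nu=j}^r x_\nu$, the numbers $\mathbb{B}^{(s_1,\ldots,s_r)}_{m_1,\ldots,m_r}$ (entire functions of $(s_j)$) are defined by \[\sum_{l_1,\ldots,l_r\ge1}\frac{\prod_{j=1}^r(1-e^{-X_j})^{l_j-1}}{\prod_{j=1}^r(l_1+\cdots+l_j)^{s_j}}=\sum_{m_1,\ldots,m_r\ge0}\mathbb{B}^{(s_1,\ldots,s_r)}_{m_1,\ldots,m_r}\frac{x_1^{m_1}\cdots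 x_r^{m_r}}{m_1!\cdots m_r!},\] for $(x_j)$ near $0$ with $|1-e^{-X_j}|<1$. *)

theory Defs
  imports "HOL-Analysis.Analysis"
begin

text \<open>
  An \<open>r\<close>-tuple is a vector over a finite linearly ordered index type \<open>'n\<close>, where \<open>r = CARD('n)\<close>
  and the elements of \<open>'n\<close> in increasing order play the role of \<open>1, ..., r\<close>.
\<close>

definition head_sum :: "'a::comm_monoid_add ^ 'n::{finite,linorder} \<Rightarrow> 'n \<Rightarrow> 'a" where
  "head_sum v j = (\<Sum>\<nu>\<in>{..j}. v $ \<nu>)"

definition tail_sum :: "'a::comm_monoid_add ^ 'n::{finite,linorder} \<Rightarrow> 'n \<Rightarrow> 'a" where
  "tail_sum v j = (\<Sum>\<nu>\<in>{j..}. v $ \<nu>)"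

definition pos_tuples :: "(nat ^ 'n::{finite,linorder}) set" where
  "pos_tuples = {l. \<forall>j. 1 \<le> l $ j}"

text \<open>The series \<open>Li\<^sup>s\<^sup>h\<close>, meaningful when every \<open>norm (z $ j) < 1\<close>.\<close>

definition Li_sh :: "complex ^ 'n::{finite,linorder} \<Rightarrow> complex ^ 'n::{finite,linorder} \<Rightarrow> complex" where
  "Li_sh s z = (\<Sum>\<^sub>\<infinity>l\<in>pos_tuples.
     (\<Prod>j\<in>UNIV. (z $ j) ^ (l $ j)) / (\<Prod>j\<in>UNIV. of_nat (head_sum l j) powr (s $ j)))"

definition mpoly_fun :: "(complex ^ 'n \<Rightarrow> complex) \<Rightarrow> bool" where
  "mpoly_fun P \<longleftrightarrow> (\<exists>(M :: (nat ^ 'n) set) c. finite M \<and>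
     (\<forall>z. P z = (\<Sum>m\<in>M. c m * (\<Prod>j\<in>UNIV. (z $ j) ^ (m $ j)))))"

text \<open>
  At a tuple \<open>-k\<close> of non-positive integers the series is the rational function
  \<open>Li_sh_neg_num k z / Li_sh_neg_den k z\<close>. Its numerator is the unique polynomial for which this
  holds on the unit polydisc; the quotient extends the series to all \<open>z\<close> with every \<open>z $ j \<noteq> 1\<close>.
\<close>

definition Li_sh_neg_den :: "nat ^ 'n::{finite,linorder} \<Rightarrow> complex ^ 'n::{finite,linorder} \<Rightarrow> complex" where
  "Li_sh_neg_den k z = (\<Prod>j\<in>UNIV. (1 - z $ j) ^ (tail_sum k j + 1))"

definition Li_sh_neg_num :: "nat ^ 'n::{finite,linorder} \<Rightarrow> complex ^ 'n::{finite,linorder} \<Rightarrow> complex" where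
  "Li_sh_neg_num k = (THE P. mpoly_fun P \<and>
     (\<forall>z. (\<forall>j. norm (z $ j) < 1) \<longrightarrow>
        Li_sh (\<chi> j. - of_nat (k $ j)) z = P z / Li_sh_neg_den k z))"

definition Li_sh_neg :: "nat ^ 'n::{finite,linorder} \<Rightarrow> complex ^ 'n::{finite,linorder} \<Rightarrow> complex" where
  "Li_sh_neg k z = Li_sh_neg_num k z / Li_sh_neg_den k z"

definition eta_neg_integral :: "nat ^ 'n::{finite,linorder} \<Rightarrow> complex ^ 'n::{finite,linorder} \<Rightarrow> complex" where
  "eta_neg_integral k s =
     1 / (\<Prod>j\<in>UNIV. Gamma (s $ j)) *
     (LINT t:{t :: real ^ 'n::{finite,linorder}. \<forall>j. 0 < t $ j}|lborel.
        (\<Prod>j\<in>UNIV. complex_of_real (t $ j) powr (s $ j - 1)) *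
        (Li_sh_neg k (\<chi> j. complex_of_real (1 - exp (tail_sum t j))) /
         (\<Prod>j\<in>UNIV. complex_of_real (1 - exp (tail_sum t j)))))"

text \<open>Holomorphic on all of \<open>\<complex>\<^sup>r\<close>: Frechet differentiable everywhere with complex linear derivative.\<close>

definition entire :: "(complex ^ 'n \<Rightarrow> complex) \<Rightarrow> bool" where
  "entire F \<longleftrightarrow> (\<forall>z. \<exists>D. (F has_derivative D) (at z) \<and> (\<forall>c v. D (c *s v) = c * D v))"

text \<open>\<open>eta_neg k s\<close> is \<open>\<eta>(-k; s)\<close>, the entire continuation of the integral.\<close>

definition eta_neg :: "nat ^ 'n::{finite,linorder} \<Rightarrow> complex ^ 'n::{finite,linorder} \<Rightarrow> complex" where
  "eta_neg k = (THE F. entire F \<and>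
     (\<forall>s. (\<forall>j. 0 < Re (s $ j)) \<longrightarrow> F s = eta_neg_integral k s))"

definition mpb_gen :: "complex ^ 'n::{finite,linorder} \<Rightarrow> complex ^ 'n::{finite,linorder} \<Rightarrow> complex" where
  "mpb_gen s x = (\<Sum>\<^sub>\<infinity>l\<in>pos_tuples.
     (\<Prod>j\<in>UNIV. (1 - exp (- tail_sum x j)) ^ (l $ j - 1)) /
     (\<Prod>j\<in>UNIV. of_nat (head_sum l j) powr (s $ j)))"

definition mpb :: "complex ^ 'n::{finite,linorder} \<Rightarrow> nat ^ 'n::{finite,linorder} \<Rightarrow> complex" where
  "mpb s = (THE b. \<forall>\<^sub>F x in nhds 0. (\<forall>j. norm (1 - exp (- tail_sum x j)) < 1) \<longrightarrow>
     ((\<lambda>m. b m * ((\<Prod>j\<in>UNIV. (x $ j) ^ (m $ j)) / (\<Prod>j\<in>UNIV. fact (m $ j))))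
        has_sum mpb_gen s x) UNIV)"

end

theory Submission
  imports Defs "HOL-Complex_Analysis.Complex_Analysis" "HOL-Real_Asymp.Real_Asymp"
begin

text \<open>
  Expand \<open>\<Prod>\<^sub>j (l\<^sub>1 + \<dots> + l\<^sub>j)\<^bsup>k\<^sub>j\<^esup>\<close> in the basis \<open>\<Prod>\<^sub>j binom(l\<^sub>j - 1 + p\<^sub>j, p\<^sub>j)\<close>, whose generating
  functions are the \<open>\<Prod>\<^sub>j (1 - z\<^sub>j)\<^bsup>-p\<^sub>j-1\<^esup>\<close>. By Newton's formula the coefficients \<open>D(k, p)\<close> are iterated
  differences of \<open>\<Prod>\<^sub>j (-q\<^sub>1 - \<dots> - q\<^sub>j)\<^bsup>k\<^sub>j\<^esup>\<close> in \<open>q\<close>. At \<open>z\<^sub>j = 1 - exp(T\<^sub>j)\<close> the integrand of \<open>\<eta>\<close> becomes a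
  finite combination of products of one-dimensional Gamma integrals, and
  \<open>\<eta>(-k; s) = \<Sum>\<^sub>p D(k, p) \<Prod>\<^sub>j (p\<^sub>1 + \<dots> + p\<^sub>j + j)\<^bsup>-s\<^sub>j\<^esup>\<close>, a finite sum which is entire in \<open>s\<close>. The same \<open>D(m, p)\<close>
  are the coefficients of \<open>x\<^sup>m / m!\<close> in \<open>\<Prod>\<^sub>j (1 - exp(-X\<^sub>j))\<^bsup>p\<^sub>j\<^esup>\<close>, so collecting powers of \<open>x\<close> in the
  generating series of \<open>B\<close> yields the same finite sum. The interchange is absolutely convergent
  because the sign of \<open>D(m, p)\<close> depends only on the parity of \<open>|m| + |p|\<close>.
\<close>

section \<open>Sums over vectors as products of one-dimensional sums\<close>

lemma bij_betw_vec_lambda_PiE: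
  "bij_betw vec_lambda (PiE UNIV B) {v::'b^'n::finite. \<forall>j. v $ j \<in> B j}"
  by (rule bij_betw_byWitness[where f' = vec_nth]) (auto simp: PiE_def Pi_def)

lemma finite_vec_box:
  assumes "\<And>j. finite (B j)"
  shows "finite {v::'b^'n::finite. \<forall>j. v $ j \<in> B j}"
proof -
  have "finite (PiE UNIV B)"
    by (rule finite_PiE) (use assms in auto)
  then show ?thesis
    using bij_betw_finite[OF bij_betw_vec_lambda_PiE] by blast
qed

lemma sum_prod_vec_box:
  fixes f :: "'n::finite \<Rightarrow> 'b \<Rightarrow> 'a::comm_semiring_1"
  assumes "\<And>j. finite (B j)"
  shows "(\<Sum>v\<in>{v::'b^'n. \<forall>j. v $ j \<in> B j}. \<Prod>j\<in>UNIV. f j (v $ j)) = (\<Prod>j\<in>UNIV. \<Sum>b\<in>B j. f j b)"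
proof -
  have "(\<Prod>j\<in>UNIV. \<Sum>b\<in>B j. f j b) = (\<Sum>g\<in>PiE UNIV B. \<Prod>j\<in>UNIV. f j (g j))"
    by (rule prod_sum_PiE) (use assms in auto)
  also have "\<dots> = (\<Sum>g\<in>PiE UNIV B. \<Prod>j\<in>UNIV. f j (vec_lambda g $ j))"
    by simp
  also have "\<dots> = (\<Sum>v\<in>{v::'b^'n. \<forall>j. v $ j \<in> B j}. \<Prod>j\<in>UNIV. f j (v $ j))"
    by (rule sum.reindex_bij_betw[OF bij_betw_vec_lambda_PiE])
  finally show ?thesis ..
qed

lemma abs_summable_on_prod_vec:
  fixes f :: "'n::finite \<Rightarrow> 'b \<Rightarrow> 'a::{banach,real_normed_field}"
  assumes "\<And>j. f j abs_summable_on UNIV"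
  shows "(\<lambda>v::'b^'n. \<Prod>j\<in>UNIV. f j (v $ j)) abs_summable_on UNIV"
  unfolding abs_summable_iff_bdd_above
proof (rule bdd_aboveI2)
  fix F :: "('b^'n) set" assume "F \<in> {F. F \<subseteq> UNIV \<and> finite F}"
  then have F: "finite F" by auto
  \<comment> \<open>A finite set of vectors lies in the box of its coordinate projections, and over
    a box the sum factors. This bounds all finite partial sums at once.\<close>
  define B where "B = (\<lambda>j. (\<lambda>v. v $ j) ` F)"
  have finB: "finite (B j)" for j
    using F by (simp add: B_def)
  have "(\<Sum>v\<in>F. norm (\<Prod>j\<in>UNIV. f j (v $ j)))
      \<le> (\<Sum>v\<in>{v. \<forall>j. v $ j \<in> B j}. \<Prod>j\<in>UNIV. norm (f j (v $ j)))"
    unfolding prod_norm[symmetric]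
    by (rule sum_mono2[OF finite_vec_box[OF finB]]) (auto simp: B_def intro: prod_nonneg)
  also have "\<dots> = (\<Prod>j\<in>UNIV. \<Sum>b\<in>B j. norm (f j b))"
    by (rule sum_prod_vec_box[OF finB])
  also have "\<dots> \<le> (\<Prod>j\<in>UNIV. \<Sum>\<^sub>\<infinity>b. norm (f j b))"
    using finB assms by (intro prod_mono conjI sum_nonneg finite_sum_le_infsum) auto
  finally show "(\<Sum>v\<in>F. norm (\<Prod>j\<in>UNIV. f j (v $ j))) \<le> (\<Prod>j\<in>UNIV. \<Sum>\<^sub>\<infinity>b. norm (f j b))" .
qed

lemma has_sum_prod_vec:
  fixes f :: "'n::finite \<Rightarrow> 'b \<Rightarrow> 'a::{banach,real_normed_field}"
  assumes abs: "\<And>j. f j abs_summable_on UNIV" and sum: "\<And>j. (f j has_sum S j) UNIV"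
  shows "((\<lambda>v::'b^'n. \<Prod>j\<in>UNIV. f j (v $ j)) has_sum (\<Prod>j\<in>UNIV. S j)) UNIV"
proof -
  have bij: "bij_betw vec_lambda (PiE UNIV (\<lambda>_. UNIV)) (UNIV :: ('b^'n) set)"
    using bij_betw_vec_lambda_PiE[where B = "\<lambda>_. UNIV" and ?'n = 'n] by simp
  have "infsum (\<lambda>v::'b^'n. \<Prod>j\<in>UNIV. f j (v $ j)) UNIV
      = infsum (\<lambda>g. \<Prod>j\<in>UNIV. f j (vec_lambda g $ j)) (PiE (UNIV::'n set) (\<lambda>_. UNIV))"
    by (rule infsum_reindex_bij_betw[OF bij, symmetric])
  also have "\<dots> = (\<Prod>j\<in>UNIV. infsum (f j) UNIV)"
    unfolding vec_lambda_beta by (rule infsum_prod_PiE_abs) (use abs in auto)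
  also have "\<dots> = (\<Prod>j\<in>UNIV. S j)"
    by (simp only: infsumI[OF sum])
  finally have "infsum (\<lambda>v::'b^'n. \<Prod>j\<in>UNIV. f j (v $ j)) UNIV = (\<Prod>j\<in>UNIV. S j)" .
  moreover have "(\<lambda>v::'b^'n. \<Prod>j\<in>UNIV. f j (v $ j)) summable_on UNIV"
    by (rule abs_summable_summable, rule abs_summable_on_prod_vec, rule abs)
  ultimately show ?thesis
    by (metis has_sum_infsum)
qed

lemma tail_sum_add: "tail_sum (u + v) j = tail_sum u j + tail_sum v j"
  by (simp add: tail_sum_def sum.distrib)

lemma tail_sum_axis: "tail_sum (axis \<nu> (c::'a::comm_monoid_add)) j = (if j \<le> \<nu> then c else 0)"
  by (simp add: tail_sum_def axis_def sum.delta)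

text \<open>Induction on the sum of the entries. It raises one exponent at a time, which is the
  shape of the recursion for \<open>newton_coeff\<close>.\<close>

lemma nat_vec_induct [case_names zero add_axis]:
  fixes m :: "nat^'n::finite"
  assumes "P 0" and "\<And>m \<nu>. P m \<Longrightarrow> P (m + axis \<nu> 1)"
  shows "P m"
proof (induction "\<Sum>j\<in>UNIV. m $ j" arbitrary: m)
  case 0
  then have "m = 0" by (simp add: vec_eq_iff)
  then show ?case using assms(1) by simp
next
  case (Suc N)
  then obtain \<nu> where \<nu>: "m $ \<nu> > 0"
    by (metis Zero_not_Suc gr0I sum.neutral)
  define m' where "m' = m - axis \<nu> 1"
  have m: "m = m' + axis \<nu> 1"
    using \<nu> by (auto simp: m'_def vec_eq_iff axis_def)
  have "(\<Sum>j\<in>UNIV. m $ j) = (\<Sum>j\<in>UNIV. m' $ j) + 1"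
    by (simp add: m sum.distrib axis_def)
  then have "P m'" using Suc by simp
  then show ?case using assms(2) m by simp
qed

lemma prod_power_add_axis:
  fixes f :: "'n::finite \<Rightarrow> 'a::comm_semiring_1"
  shows "(\<Prod>j\<in>UNIV. f j ^ ((m + axis \<nu> 1) $ j)) = f \<nu> * (\<Prod>j\<in>UNIV. f j ^ (m $ j))"
proof -
  have "(\<Prod>j\<in>UNIV. f j ^ ((m + axis \<nu> 1) $ j))
      = (\<Prod>j\<in>UNIV. f j ^ (m $ j)) * (\<Prod>j\<in>UNIV. if \<nu> = j then f j else 1)"
    unfolding prod.distrib[symmetric] by (intro prod.cong) (auto simp: axis_def mult.commute)
  then show ?thesis by (simp add: mult.commute)
qed

section \<open>Newton coefficients: recursion, sign, support and expansion\<close>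

text \<open>The D(m, p) of the overview. For a single variable this is
  \<open>(-1)^(m+p) * p! * S(m,p)\<close> with S the Stirling numbers of the second kind.\<close>

definition newton_coeff :: "nat^'n::{finite,linorder} \<Rightarrow> nat^'n::{finite,linorder} \<Rightarrow> real" where
  "newton_coeff m p = (\<Sum>q\<in>{q. \<forall>j. q $ j \<le> p $ j}.
     (\<Prod>j\<in>UNIV. (-1) ^ (q $ j) * real (p $ j choose q $ j)) * (\<Prod>j\<in>UNIV. (- real (head_sum q j)) ^ (m $ j)))"

lemma finite_vec_atMost: "finite {q::nat^'n::finite. \<forall>j. q $ j \<le> b j}"
  using finite_vec_box[where B = "\<lambda>j. {..b j}"] by simp

lemma newton_coeff_zero: "newton_coeff 0 p = (if p = 0 then 1 else 0)"
proof -
  have "newton_coeff 0 p = (\<Prod>j\<in>UNIV. \<Sum>b\<le>p $ j. (-1) ^ b * real (p $ j choose b))"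
    unfolding newton_coeff_def
    using sum_prod_vec_box[where B = "\<lambda>j. {..p $ j}" and f = "\<lambda>j b. (-1) ^ b * real (p $ j choose b)"]
    by simp
  also have "\<dots> = (\<Prod>j\<in>UNIV. if p $ j = 0 then 1 else 0)"
    by (intro prod.cong) (auto simp: choose_alternating_sum)
  also have "\<dots> = (if p = 0 then 1 else 0)"
    by (auto simp: vec_eq_iff)
  finally show ?thesis .
qed

text \<open>Absorption q C(p,q) = p C(p-1,q-1) combined with Pascal's rule. For p = 0 both sides
  vanish, so the truncated \<open>p - 1\<close> is harmless.\<close>

lemma binomial_weight_shift:
  "(-1) ^ q * real (p choose q) * real q
    = real p * ((-1) ^ q * real (p choose q) - (-1) ^ q * real (p - 1 choose q))"
proof (cases p; cases q)
  fix p' q' assume *: "p = Suc p'" "q = Suc q'"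
  have "real (Suc q') * real (Suc p' choose Suc q') = real (Suc p') * real (p' choose q')"
    by (metis Suc_times_binomial of_nat_mult)
  from arg_cong[OF this, of "\<lambda>x. (-1) ^ Suc q' * x"] show ?thesis
    unfolding * by (simp add: algebra_simps)
qed auto

text \<open>Raising the exponent at \<open>\<nu>\<close> multiplies each summand by -(q_1 + ... +
  q_\<nu>), and \<open>binomial_weight_shift\<close> trades each factor q_i for a difference in p_i.
  For one variable this is the Stirling recurrence S(m+1,p) = S(m,p-1) + p S(m,p).\<close>

lemma newton_coeff_add_axis:
  fixes m p :: "nat^'n::{finite,linorder}"
  shows "newton_coeff (m + axis \<nu> 1) p
    = (\<Sum>i\<le>\<nu>. real (p $ i) * (newton_coeff m (p - axis i 1) - newton_coeff m p))"
proof -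
  define w where "w = (\<lambda>a b::nat. (-1) ^ b * real (a choose b))"
  define W where "W = (\<lambda>p q::(nat, 'n) vec. \<Prod>j\<in>UNIV. w (p $ j) (q $ j))"
  define G where "G = (\<lambda>q::(nat, 'n) vec. \<Prod>j\<in>UNIV. (- real (head_sum q j)) ^ (m $ j))"
  define B where "B = {q. \<forall>j. q $ j \<le> p $ j}"
  \<comment> \<open>Outside the smaller box a binomial coefficient is 0, so the sums for
    \<open>p\<close> and for \<open>p - axis i 1\<close> can share the index set
    \<open>B\<close>.\<close>
  have D: "newton_coeff m p' = (\<Sum>q\<in>B. W p' q * G q)" if "\<And>j. p' $ j \<le> p $ j" for p'
    unfolding newton_coeff_def W_def G_def w_def
  proof (rule sum.mono_neutral_left)
    show "finite B" unfolding B_def by (rule finite_vec_atMost)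
    show "{q. \<forall>j. q $ j \<le> p' $ j} \<subseteq> B" using that order_trans unfolding B_def by blast
    show "\<forall>q\<in>B - {q. \<forall>j. q $ j \<le> p' $ j}. (\<Prod>j\<in>UNIV. (-1) ^ (q $ j) * real (p' $ j choose q $ j)) *
        (\<Prod>j\<in>UNIV. (- real (head_sum q j)) ^ (m $ j)) = 0"
      by (auto simp: not_le)
  qed
  have shift: "real (p $ i) * (W p q - W (p - axis i 1) q) = real (q $ i) * W p q" for i q
  proof -
    have W: "W p' q = w (p' $ i) (q $ i) * (\<Prod>j\<in>UNIV - {i}. w (p' $ j) (q $ j))" for p'
      unfolding W_def by (rule prod.remove) auto
    have "(\<Prod>j\<in>UNIV - {i}. w ((p - axis i 1) $ j) (q $ j)) = (\<Prod>j\<in>UNIV - {i}. w (p $ j) (q $ j))"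
      by (intro prod.cong) (auto simp: axis_def)
    moreover have "w (p $ i) (q $ i) * real (q $ i)
        = real (p $ i) * (w (p $ i) (q $ i) - w ((p - axis i 1) $ i) (q $ i))"
      using binomial_weight_shift[of "q $ i" "p $ i"] by (simp add: w_def)
    moreover have "c * (a * R - b * R) = d * (a * R)" if "a * d = c * (a - b)" for a b c d R :: real
      using that by algebra
    ultimately show ?thesis
      unfolding W[of p] W[of "p - axis i 1"] by presburger
  qed
  have "newton_coeff (m + axis \<nu> 1) p = (\<Sum>q\<in>B. W p q * (- real (head_sum q \<nu>) * G q))"
    unfolding newton_coeff_def W_def w_def B_def G_def prod_power_add_axis ..
  also have "\<dots> = (\<Sum>q\<in>B. \<Sum>i\<le>\<nu>. - (real (q $ i) * W p q) * G q)"
    by (simp add: head_sum_def sum_distrib_left sum_distrib_right sum_negf algebra_simps)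
  also have "\<dots> = (\<Sum>i\<le>\<nu>. \<Sum>q\<in>B. - (real (q $ i) * W p q) * G q)"
    by (rule sum.swap)
  also have "\<dots> = (\<Sum>i\<le>\<nu>. real (p $ i) * ((\<Sum>q\<in>B. W (p - axis i 1) q * G q) - (\<Sum>q\<in>B. W p q * G q)))"
    unfolding shift[symmetric]
    by (simp add: sum_distrib_left sum_subtractf[symmetric] algebra_simps)
  also have "\<dots> = (\<Sum>i\<le>\<nu>. real (p $ i) * (newton_coeff m (p - axis i 1) - newton_coeff m p))"
    by (subst (1 2) D) auto
  finally show ?thesis .
qed

text \<open>By induction the two coefficients subtracted in the recursion have opposite signs (or
  vanish), since |p| differs by one between them. Nothing cancels, and the sign is fixed by the
  parity of |m| + |p|.\<close>

lemma newton_coeff_sign: "\<bar>newton_coeff m p\<bar> = (-1) ^ ((\<Sum>j\<in>UNIV. m $ j) + (\<Sum>j\<in>UNIV. p $ j)) * newton_coeff m p"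
proof -
  have "0 \<le> (-1) ^ ((\<Sum>j\<in>UNIV. m $ j) + (\<Sum>j\<in>UNIV. p $ j)) * newton_coeff m p"
  proof (induction m arbitrary: p rule: nat_vec_induct)
    case zero
    then show ?case by (simp add: newton_coeff_zero)
  next
    case (add_axis m \<nu>)
    have sum: "(\<Sum>j\<in>UNIV. (m + axis \<nu> 1) $ j) = Suc (\<Sum>j\<in>UNIV. m $ j)"
      by (simp add: sum.distrib axis_def)
    have "0 \<le> (-1) ^ (Suc (\<Sum>j\<in>UNIV. m $ j) + (\<Sum>j\<in>UNIV. p $ j)) *
        (real (p $ i) * (newton_coeff m (p - axis i 1) - newton_coeff m p))" for i
    proof (cases "p $ i = 0")
      case False
      have p: "p = (p - axis i 1) + axis i 1"
        using False by (auto simp: vec_eq_iff axis_def)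
      have *: "(\<Sum>j\<in>UNIV. p $ j) = Suc (\<Sum>j\<in>UNIV. (p - axis i 1) $ j)"
        by (subst p) (simp add: sum.distrib axis_def del: vector_minus_component)
      have "0 \<le> real (p $ i) * ((-1) ^ ((\<Sum>j\<in>UNIV. m $ j) + (\<Sum>j\<in>UNIV. (p - axis i 1) $ j)) * newton_coeff m (p - axis i 1)
         + (-1) ^ ((\<Sum>j\<in>UNIV. m $ j) + (\<Sum>j\<in>UNIV. p $ j)) * newton_coeff m p)"
        by (intro mult_nonneg_nonneg add_nonneg_nonneg add_axis.IH) auto
      then show ?thesis
        unfolding * by (simp add: algebra_simps)
    qed auto
    then show ?case
      unfolding newton_coeff_add_axis sum sum_distrib_left by (intro sum_nonneg) auto
  qed
  then show ?thesis
    using abs_of_nonneg by (fastforce simp: abs_mult)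
qed

text \<open>A difference of order \<open>p $ j\<close> in q_j kills a polynomial of smaller degree;
  q_j occurs exactly in the head sums with index at least j, so the degree is
  \<open>tail_sum m j\<close>. The proof reads this off the recursion.\<close>

lemma newton_coeff_eq_0:
  assumes "tail_sum m j < p $ j"
  shows "newton_coeff m p = 0"
  using assms
proof (induction m arbitrary: p rule: nat_vec_induct)
  case zero
  then show ?case by (auto simp: newton_coeff_zero)
next
  case (add_axis m \<nu>)
  have "newton_coeff m p = 0"
    using add_axis by (simp add: tail_sum_add)
  \<comment> \<open>For i = j the entry of p at j drops by one, but \<open>tail_sum\<close> at j has
    grown by one too; for i different from j that entry is unchanged.\<close>
  moreover have "newton_coeff m (p - axis i 1) = 0" if "i \<le> \<nu>" for i
    using add_axis.prems that
    by (intro add_axis.IH, cases "i = j") (auto simp: tail_sum_add tail_sum_axis axis_def[of i] split: if_splits)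
  ultimately show ?case
    unfolding newton_coeff_add_axis by simp
qed

text \<open>Multiplying by l_i + 1 acts on the binomial basis as (l+1) C(l+p,p) = (p+1) C(l+p+1,p+1)
  - p C(l+p,p), which reproduces the recursion for the coefficients. The uniform bound
  \<open>N\<close> keeps the index box fixed during the induction on \<open>m\<close>.\<close>

lemma newton_expansion_bounded:
  fixes m l :: "nat^'n::{finite,linorder}"
  assumes "(\<Sum>j\<in>UNIV. m $ j) \<le> N"
  shows "(\<Prod>j\<in>UNIV. real (head_sum (l + 1) j) ^ (m $ j))
    = (\<Sum>p\<in>{p. \<forall>j. p $ j \<le> N}. newton_coeff m p * (\<Prod>j\<in>UNIV. real (l $ j + p $ j choose p $ j)))"
  using assms
proof (induction m rule: nat_vec_induct)
  case zero
  then show ?case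
    by (simp add: newton_coeff_zero if_distrib[of "\<lambda>x. x * _"] sum.delta[OF finite_vec_atMost] cong: if_cong)
next
  case (add_axis m \<nu>)
  define B where "B = {p::(nat, 'n) vec. \<forall>j. p $ j \<le> N}"
  define C where "C = (\<lambda>p::(nat, 'n) vec. \<Prod>j\<in>UNIV. real (l $ j + p $ j choose p $ j))"
  have N: "Suc (\<Sum>j\<in>UNIV. m $ j) \<le> N"
    using add_axis.prems by (simp add: sum.distrib axis_def)
  have finB: "finite B" unfolding B_def by (rule finite_vec_atMost)
  have step: "real (l $ i + 1) * C p = real (p $ i + 1) * C (p + axis i 1) - real (p $ i) * C p" for i p
  proof -
    have C: "C p' = real (l $ i + p' $ i choose p' $ i) * (\<Prod>j\<in>UNIV - {i}. real (l $ j + p' $ j choose p' $ j))" for p'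
      unfolding C_def by (rule prod.remove) auto
    have *: "(\<Prod>j\<in>UNIV - {i}. real (l $ j + (p + axis i 1) $ j choose (p + axis i 1) $ j))
        = (\<Prod>j\<in>UNIV - {i}. real (l $ j + p $ j choose p $ j))"
      by (intro prod.cong) (auto simp: axis_def)
    have "real (Suc (p $ i)) * real (Suc (l $ i + p $ i) choose Suc (p $ i))
        = real (Suc (l $ i + p $ i)) * real (l $ i + p $ i choose p $ i)"
      by (metis Suc_times_binomial of_nat_mult)
    then show ?thesis
      unfolding C[of p] C[of "p + axis i 1"] * by (simp add: algebra_simps flip: mult.assoc)
  qed
  \<comment> \<open>Reindexing by p_i -> p_i + 1. The layer p_i = N is lost on the left, where the
    coefficient is 0 because |m| < N; the layer p_i = 0 is missing on the right, where the factor
    p_i is 0.\<close>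
  have shift: "(\<Sum>p\<in>B. newton_coeff m p * (real (p $ i + 1) * C (p + axis i 1)))
      = (\<Sum>p\<in>B. real (p $ i) * newton_coeff m (p - axis i 1) * C p)" for i
  proof (rule sum.reindex_bij_witness_not_neutral[where
        S' = "{p\<in>B. p $ i = N}" and T' = "{p\<in>B. p $ i = 0}" and i = "\<lambda>p. p - axis i 1" and j = "\<lambda>p. p + axis i 1"])
    show "newton_coeff m p * (real (p $ i + 1) * C (p + axis i 1)) = 0" if "p \<in> {p\<in>B. p $ i = N}" for p
    proof -
      have "tail_sum m i \<le> (\<Sum>j\<in>UNIV. m $ j)"
        unfolding tail_sum_def by (rule sum_mono2) auto
      then have "newton_coeff m p = 0"
        using that N by (intro newton_coeff_eq_0[of _ i]) auto
      then show ?thesis by simp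
    qed
    show "p + axis i 1 \<in> B - {p \<in> B. p $ i = 0}" if "p \<in> B - {p \<in> B. p $ i = N}" for p
    proof -
      have "(p + axis i 1) $ j \<le> N" for j
        using that by (cases "j = i") (auto simp: B_def axis_def Suc_le_eq order.not_eq_order_implies_strict)
      then show ?thesis by (simp add: B_def)
    qed
    show "p - axis i 1 \<in> B - {p \<in> B. p $ i = N}" if "p \<in> B - {p \<in> B. p $ i = 0}" for p
    proof -
      have "p $ j \<le> N" for j using that by (simp add: B_def)
      then have "(p - axis i 1) $ j \<le> N" for j by (simp add: le_diff_conv trans_le_add1)
      moreover have "p $ i - 1 < N"
        using that by (auto simp: B_def intro: less_le_trans[of _ "p $ i"])
      ultimately show ?thesis by (simp add: B_def)
    qed
  qed (use finB in \<open>auto simp: B_def vec_eq_iff axis_def\<close>)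
  have "(\<Prod>j\<in>UNIV. real (head_sum (l + 1) j) ^ ((m + axis \<nu> 1) $ j))
      = real (head_sum (l + 1) \<nu>) * (\<Sum>p\<in>B. newton_coeff m p * C p)"
    unfolding prod_power_add_axis B_def C_def using add_axis N by simp
  also have "\<dots> = (\<Sum>i\<le>\<nu>. \<Sum>p\<in>B. newton_coeff m p * (real (l $ i + 1) * C p))"
    by (simp add: head_sum_def sum_distrib_right sum_distrib_left mult_ac)
  also have "\<dots> = (\<Sum>i\<le>\<nu>. (\<Sum>p\<in>B. newton_coeff m p * (real (p $ i + 1) * C (p + axis i 1)))
       - (\<Sum>p\<in>B. newton_coeff m p * (real (p $ i) * C p)))"
    unfolding step by (simp add: sum_subtractf right_diff_distrib)
  also have "\<dots> = (\<Sum>i\<le>\<nu>. \<Sum>p\<in>B. real (p $ i) * (newton_coeff m (p - axis i 1) - newton_coeff m p) * C p)"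
    unfolding shift by (simp add: sum_subtractf[symmetric] algebra_simps)
  also have "\<dots> = (\<Sum>p\<in>B. newton_coeff (m + axis \<nu> 1) p * C p)"
    unfolding newton_coeff_add_axis sum_distrib_right by (rule sum.swap)
  finally show ?case unfolding B_def C_def .
qed

lemma newton_expansion:
  fixes m l :: "nat^'n::{finite,linorder}"
  shows "(\<Prod>j\<in>UNIV. real (head_sum (l + 1) j) ^ (m $ j))
    = (\<Sum>p\<in>{p. \<forall>j. p $ j \<le> tail_sum m j}. newton_coeff m p * (\<Prod>j\<in>UNIV. real (l $ j + p $ j choose p $ j)))"
proof -
  have "tail_sum m j \<le> (\<Sum>j\<in>UNIV. m $ j)" for j
    unfolding tail_sum_def by (rule sum_mono2) auto
  then have "{p. \<forall>j. p $ j \<le> tail_sum m j} \<subseteq> {p. \<forall>j. p $ j \<le> (\<Sum>j\<in>UNIV. m $ j)}"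
    using order_trans by blast
  then show ?thesis
    unfolding newton_expansion_bounded[OF order_refl]
    using newton_coeff_eq_0[of m]
    by (intro sum.mono_neutral_right[OF finite_vec_atMost]) (force simp: not_le)+
qed

section \<open>The exponential generating function of the Newton coefficients\<close>

lemma has_sum_finite_sum:
  fixes f :: "'i \<Rightarrow> 'b \<Rightarrow> 'a::topological_comm_monoid_add"
  assumes "finite I" "\<And>i. i \<in> I \<Longrightarrow> (f i has_sum S i) A"
  shows "((\<lambda>x. \<Sum>i\<in>I. f i x) has_sum (\<Sum>i\<in>I. S i)) A"
  using assms by (induction I) (auto intro!: has_sum_add)

lemma exp_has_sum:
  fixes x :: "'a::{real_normed_field,banach}"
  shows "((\<lambda>n. x ^ n / fact n) has_sum exp x) UNIV"
    and "(\<lambda>n. x ^ n / fact n) abs_summable_on UNIV"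
proof -
  have *: "summable (\<lambda>n. norm (x ^ n / fact n))"
    using summable_norm_exp[of x] by (simp add: field_simps scaleR_conv_of_real norm_mult norm_divide)
  have "(\<lambda>n. x ^ n / fact n) sums exp x"
    using exp_converges[of x] by (simp add: scaleR_conv_of_real field_simps)
  then show "((\<lambda>n. x ^ n / fact n) has_sum exp x) UNIV"
    by (intro norm_summable_imp_has_sum *)
  show "(\<lambda>n. x ^ n / fact n) abs_summable_on UNIV"
    using * by (subst summable_on_UNIV_nonneg_real_iff) auto
qed

text \<open>Both sides sum q_i x_j over the pairs i \<le> j. This duality separates the variables in
  exponentials of tail sums, both in the generating function and in the integral.\<close>

lemma sum_head_sum_mult:
  fixes x :: "'a::comm_semiring_1^'n::{finite,linorder}"
  shows "(\<Sum>j\<in>UNIV. of_nat (head_sum q j) * x $ j) = (\<Sum>j\<in>UNIV. of_nat (q $ j) * tail_sum x j)"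
proof -
  have "(\<Sum>j\<in>UNIV. of_nat (head_sum q j) * x $ j) = (\<Sum>j\<in>UNIV. \<Sum>i | i \<in> UNIV \<and> i \<le> j. of_nat (q $ i) * x $ j)"
    by (simp add: head_sum_def sum_distrib_right atMost_def)
  also have "\<dots> = (\<Sum>i\<in>UNIV. \<Sum>j | j \<in> UNIV \<and> i \<le> j. of_nat (q $ i) * x $ j)"
    by (rule sum.swap_restrict) auto
  finally show ?thesis
    by (simp add: tail_sum_def sum_distrib_left atLeast_def)
qed

text \<open>Expand each power of 1 - exp(-X_j) binomially. By the duality the product of the
  exp(-q_j X_j) is a product of exponentials in the single x_j, whose power series multiply. Real
  and complex instances are both used.\<close>

lemma newton_coeff_has_sum:
  fixes x :: "'a::{real_normed_field,banach}^'n::{finite,linorder}"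
  shows "((\<lambda>m. of_real (newton_coeff m p) * (\<Prod>j\<in>UNIV. x $ j ^ (m $ j) / fact (m $ j)))
    has_sum (\<Prod>j\<in>UNIV. (1 - exp (- tail_sum x j)) ^ (p $ j))) UNIV"
proof -
  define Q where "Q = {q. \<forall>j. q $ j \<le> p $ j}"
  define c :: "nat^'n::{finite,linorder} \<Rightarrow> 'a" where
    "c = (\<lambda>q. \<Prod>j\<in>UNIV. (-1) ^ (q $ j) * of_nat (p $ j choose q $ j))"
  have finQ: "finite Q" unfolding Q_def by (rule finite_vec_atMost)
  have expq: "((\<lambda>m. \<Prod>j\<in>UNIV. (- of_nat (head_sum q j) * x $ j) ^ (m $ j) / fact (m $ j))
      has_sum (\<Prod>j\<in>UNIV. exp (- tail_sum x j) ^ (q $ j))) UNIV" for q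
  proof -
    have "(\<Prod>j\<in>UNIV. exp (- of_nat (head_sum q j) * x $ j)) = exp (- (\<Sum>j\<in>UNIV. of_nat (head_sum q j) * x $ j))"
      by (simp add: exp_sum flip: sum_negf)
    also have "\<dots> = (\<Prod>j\<in>UNIV. exp (- tail_sum x j) ^ (q $ j))"
      unfolding sum_head_sum_mult by (simp add: exp_sum flip: sum_negf exp_of_nat_mult)
    finally have eq: "(\<Prod>j\<in>UNIV. exp (- of_nat (head_sum q j) * x $ j)) = (\<Prod>j\<in>UNIV. exp (- tail_sum x j) ^ (q $ j))" .
    show ?thesis
      unfolding eq[symmetric]
      by (rule has_sum_prod_vec[where f = "\<lambda>j b. (- of_nat (head_sum q j) * x $ j) ^ b / fact b"]; rule exp_has_sum)
  qed
  have "((\<lambda>m. \<Sum>q\<in>Q. c q * (\<Prod>j\<in>UNIV. (- of_nat (head_sum q j) * x $ j) ^ (m $ j) / fact (m $ j)))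
      has_sum (\<Sum>q\<in>Q. c q * (\<Prod>j\<in>UNIV. exp (- tail_sum x j) ^ (q $ j)))) UNIV"
    by (intro has_sum_finite_sum finQ has_sum_cmult_right expq)
  moreover have "(\<Sum>q\<in>Q. c q * (\<Prod>j\<in>UNIV. (- of_nat (head_sum q j) * x $ j) ^ (m $ j) / fact (m $ j)))
      = of_real (newton_coeff m p) * (\<Prod>j\<in>UNIV. x $ j ^ (m $ j) / fact (m $ j))" for m
    unfolding newton_coeff_def Q_def[symmetric] c_def of_real_sum sum_distrib_right
    unfolding power_mult_distrib prod_dividef prod.distrib
    by (intro sum.cong refl) (simp add: prod.distrib)
  moreover have "(\<Sum>q\<in>Q. c q * (\<Prod>j\<in>UNIV. exp (- tail_sum x j) ^ (q $ j)))
      = (\<Prod>j\<in>UNIV. (1 - exp (- tail_sum x j)) ^ (p $ j))"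
  proof -
    have "(1 - y) ^ n = (\<Sum>b\<le>n. (-1) ^ b * of_nat (n choose b) * y ^ b)" for y :: 'a and n
      using binomial_ring[of "- y" 1 n] by (simp add: mult_ac power_minus[of y])
    then show ?thesis
      using sum_prod_vec_box[where B = "\<lambda>j. {..p $ j}"
          and f = "\<lambda>j b. (-1) ^ b * of_nat (p $ j choose b) * exp (- tail_sum x j) ^ b"]
      by (simp add: c_def Q_def prod.distrib)
  qed
  ultimately show ?thesis by simp
qed

text \<open>Substitute \<open>- y\<close> in the previous series: the sign (-1)^|m| comes from the
  monomials and (-1)^|p| from the right-hand side, and together they turn each coefficient into its
  absolute value.\<close>

lemma abs_newton_coeff_has_sum:
  fixes y :: "real^'n::{finite,linorder}"
  shows "((\<lambda>m. \<bar>newton_coeff m p\<bar> * (\<Prod>j\<in>UNIV. y $ j ^ (m $ j) / fact (m $ j)))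
    has_sum (\<Prod>j\<in>UNIV. (exp (tail_sum y j) - 1) ^ (p $ j))) UNIV"
proof -
  have "tail_sum (- y) j = - tail_sum y j" for j
    by (simp add: tail_sum_def sum_negf)
  moreover have "(-1) ^ (\<Sum>j\<in>UNIV. p $ j) * (\<Prod>j\<in>UNIV. (1 - exp (tail_sum y j)) ^ (p $ j))
      = (\<Prod>j\<in>UNIV. (exp (tail_sum y j) - 1) ^ (p $ j))"
    by (simp add: power_sum flip: prod.distrib power_mult_distrib)
  moreover have "(-1) ^ (\<Sum>j\<in>UNIV. p $ j) * (newton_coeff m p * (\<Prod>j\<in>UNIV. (- y) $ j ^ (m $ j) / fact (m $ j)))
      = \<bar>newton_coeff m p\<bar> * (\<Prod>j\<in>UNIV. y $ j ^ (m $ j) / fact (m $ j))" for m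
    unfolding newton_coeff_sign
    by (simp add: power_add power_sum prod_dividef prod.distrib power_minus[of "y $ _"] mult_ac)
  ultimately show ?thesis
    using has_sum_cmult_right[OF newton_coeff_has_sum[of p "- y"], of "(-1) ^ (\<Sum>j\<in>UNIV. p $ j)"]
    by simp
qed

section \<open>Uniqueness of the coefficients of power series in several variables\<close>

lemma powser_coeff_eq_0:
  fixes d :: "nat \<Rightarrow> complex"
  assumes "0 < r" and sums: "\<And>w. norm w < r \<Longrightarrow> (\<lambda>n. w ^ n * d n) sums 0"
  shows "d n = 0"
proof (rule ccontr)
  assume n: "d n \<noteq> 0"
  have sums': "(\<lambda>n. d n * w ^ n) sums 0" if "norm w < r" for w
    using sums[OF that] by (simp only: mult.commute)
  have "d 0 = 0"
    using sums'[of 0] \<open>0 < r\<close> by (intro sums_unique2[OF powser_sums_zero]) auto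
  then have "0 < n" using n by (cases n) auto
  show False
  \<comment> \<open>A nonzero coefficient of positive index makes 0 an isolated zero of the sum, but
    the sum is identically 0. The index 0 was excluded by evaluating at 0.\<close>
  proof (rule powser_0_nonzero[of r 0 d "\<lambda>_. 0" n])
    fix s :: real assume "0 < s" and s: "\<And>z::complex. z \<in> cball 0 s - {0} \<Longrightarrow> (0::complex) \<noteq> 0"
    then show False using s[of "of_real s"] by auto
  qed (use n sums' \<open>0 < r\<close> \<open>0 < n\<close> in auto)
qed

text \<open>The variables are split off one after the other: when those indexed by \<open>A\<close> are gone, every
  partial series over a fibre of the exponents at \<open>A\<close> vanishes.\<close>

lemma has_sum_0_imp_coeff_eq_0:
  fixes d :: "nat^'n \<Rightarrow> complex"
  assumes ev: "\<forall>\<^sub>F x :: complex^'n::finite in nhds 0. ((\<lambda>m. d m * (\<Prod>j\<in>UNIV. x $ j ^ (m $ j))) has_sum 0) UNIV"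
  shows "d m = 0"
proof -
  from ev obtain e where "0 < e" and e:
    "\<And>x :: complex^'n. norm x < e \<Longrightarrow> ((\<lambda>m. d m * (\<Prod>j\<in>UNIV. x $ j ^ (m $ j))) has_sum 0) UNIV"
    unfolding eventually_nhds_metric by auto
  \<comment> \<open>The polydisc of this radius lies in the ball of radius \<open>e\<close>, since
    the norm is at most the sum of the coordinate norms.\<close>
  define \<delta> where "\<delta> = e / real CARD('n)"
  have "0 < \<delta>" using \<open>0 < e\<close> by (simp add: \<delta>_def)
  have small: "norm x < e" if "\<And>j. norm (x $ j) < \<delta>" for x :: "complex^'n"
  proof -
    have "norm x \<le> (\<Sum>j\<in>UNIV. norm (x $ j))"
      unfolding norm_vec_def by (rule L2_set_le_sum) auto
    also have "\<dots> < (\<Sum>j\<in>(UNIV::'n set). \<delta>)"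
      using that by (intro sum_strict_mono) auto
    finally show ?thesis by (simp add: \<delta>_def)
  qed
  have "((\<lambda>m. d m * (\<Prod>j\<in>-A. x $ j ^ (m $ j))) has_sum 0) {m. \<forall>j\<in>A. m $ j = m' $ j}"
    if "finite A" "\<And>j. norm (x $ j) < \<delta>" for A m' and x :: "complex^'n"
    using that
  proof (induction A arbitrary: x m')
    case empty
    then show ?case using e[OF small] by simp
  next
    case (insert a A)
    define F where "F = {m::nat^'n. \<forall>j\<in>A. m $ j = m' $ j}"
    define Fn where "Fn = (\<lambda>n. {m::nat^'n. m $ a = n \<and> (\<forall>j\<in>A. m $ j = m' $ j)})"
    define g where "g = (\<lambda>m. d m * (\<Prod>j\<in>- insert a A. x $ j ^ (m $ j)))"
    have ins: "- A = insert a (- insert a A)" using insert.hyps by auto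
    have sum0: "((\<lambda>m. w ^ (m $ a) * g m) has_sum 0) F" if "norm w < \<delta>" for w
    proof -
      \<comment> \<open>Letting coordinate \<open>a\<close> vary turns the induction hypothesis at
        \<open>y\<close> into a power series in \<open>w\<close> whose coefficients are the sums of
        \<open>g\<close> over the slices \<open>Fn n\<close>.\<close>
      define y where "y = (\<chi> j. if j = a then w else x $ j)"
      have "d m * (\<Prod>j\<in>- A. y $ j ^ (m $ j)) = w ^ (m $ a) * g m" for m
      proof -
        have "(\<Prod>j\<in>- A. y $ j ^ (m $ j)) = w ^ (m $ a) * (\<Prod>j\<in>- insert a A. y $ j ^ (m $ j))"
          by (subst ins, subst prod.insert) (auto simp: y_def)
        also have "(\<Prod>j\<in>- insert a A. y $ j ^ (m $ j)) = (\<Prod>j\<in>- insert a A. x $ j ^ (m $ j))"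
          by (intro prod.cong) (auto simp: y_def)
        finally show ?thesis by (simp add: g_def)
      qed
      then show ?thesis
        using insert.IH[of y m'] insert.prems that by (simp add: F_def y_def)
    qed
    have "g summable_on Fn n" for n
    proof -
      \<comment> \<open>A nonzero point of the disc is taken so that the constant factor w^n can be
        divided out on the slice.\<close>
      have w: "norm (complex_of_real (\<delta> / 2)) < \<delta>" using \<open>0 < \<delta>\<close> by simp
      have "(\<lambda>m. complex_of_real (\<delta> / 2) ^ (m $ a) * g m) summable_on Fn n"
        by (rule summable_on_subset_banach[OF has_sum_imp_summable[OF sum0[OF w]]]) (auto simp: F_def Fn_def)
      also have "?this \<longleftrightarrow> (\<lambda>m. complex_of_real (\<delta> / 2) ^ n * g m) summable_on Fn n"
        by (intro summable_on_cong) (auto simp: Fn_def)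
      finally show ?thesis
        using \<open>0 < \<delta>\<close> by (subst (asm) summable_on_cmult_right') auto
    qed
    then have S: "(g has_sum infsum g (Fn n)) (Fn n)" for n
      by (rule has_sum_infsum)
    have "(\<lambda>n. w ^ n * infsum g (Fn n)) sums 0" if "norm w < \<delta>" for w
    proof -
      have "bij_betw snd (Sigma UNIV Fn) F"
        by (rule bij_betw_byWitness[where f' = "\<lambda>m. (m $ a, m)"]) (auto simp: Fn_def F_def)
      from has_sum_reindex_bij_betw[OF this, of "\<lambda>m. w ^ (m $ a) * g m"] sum0[OF that]
      have "((\<lambda>p. w ^ (snd p $ a) * g (snd p)) has_sum 0) (Sigma UNIV Fn)" by simp
      moreover have "((\<lambda>m. w ^ (snd (n, m) $ a) * g (snd (n, m))) has_sum (w ^ n * infsum g (Fn n))) (Fn n)" for n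
        using has_sum_cmult_right[OF S[of n], of "w ^ n"]
        by (subst has_sum_cong[where g = "\<lambda>m. w ^ n * g m"]) (auto simp: Fn_def)
      ultimately have "((\<lambda>n. w ^ n * infsum g (Fn n)) has_sum 0) UNIV"
        by (rule has_sum_Sigma')
      then show ?thesis by (rule has_sum_imp_sums)
    qed
    then have "infsum g (Fn (m' $ a)) = 0"
      by (rule powser_coeff_eq_0[OF \<open>0 < \<delta>\<close>])
    then show ?case
      using S[of "m' $ a"] by (simp add: g_def Fn_def)
  qed
  \<comment> \<open>With all variables split off, the monomial is an empty product and the fibre is
    the single exponent \<open>m\<close>.\<close>
  from this[of UNIV 0 m] \<open>0 < \<delta>\<close> have "(d has_sum 0) {m}"
    by (simp flip: vec_eq_iff)
  moreover have "(d has_sum d m) {m}" by (rule has_sum_finiteI) auto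
  ultimately show ?thesis by (rule has_sum_unique[symmetric])
qed

subsection \<open>The poly-Bernoulli numbers\<close>

text \<open>The common value of both sides of the theorem. \<open>head_sum (p + 1) j\<close> is p_1
  + ... + p_j + j, and by \<open>newton_coeff_eq_0\<close> the box contains every p with nonzero
  coefficient.\<close>

definition newton_dirichlet :: "nat^'n::{finite,linorder} \<Rightarrow> complex^'n::{finite,linorder} \<Rightarrow> complex" where
  "newton_dirichlet k s = (\<Sum>p\<in>{p. \<forall>j. p $ j \<le> tail_sum k j}.
     of_real (newton_coeff k p) / (\<Prod>j\<in>UNIV. of_nat (head_sum (p + 1) j) powr (s $ j)))"

lemma head_sum_add_one_pos: "0 < head_sum (p + 1 :: nat^'n::{finite,linorder}) j"
  unfolding head_sum_def by (rule sum_pos) auto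

text \<open>Every head sum lies between 1 and N times the product of the p_i + 1, so the growth is
  polynomial for every \<open>s\<close>. The bound is a product over coordinates so that summability
  reduces to one variable.\<close>

lemma head_sum_powr_bound:
  fixes s :: "complex^'n::{finite,linorder}"
  obtains C M where "C \<ge> 0"
    "\<And>p. norm (inverse (\<Prod>j\<in>UNIV. of_nat (head_sum (p + 1) j) powr (s $ j))) \<le> C * (\<Prod>j\<in>UNIV. real (p $ j + 1) ^ M)"
proof -
  define K where "K = nat \<lceil>\<Sum>j\<in>UNIV. \<bar>Re (s $ j)\<bar>\<rceil>"
  define N where "N = CARD('n)"
  have K: "- Re (s $ j) \<le> real K" for j
  proof -
    have "\<bar>Re (s $ j)\<bar> \<le> (\<Sum>j\<in>UNIV. \<bar>Re (s $ j)\<bar>)"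
      by (rule member_le_sum) auto
    then show ?thesis unfolding K_def by linarith
  qed
  have "norm (inverse (\<Prod>j\<in>UNIV. of_nat (head_sum (p + 1) j) powr (s $ j)))
      \<le> (real N ^ K) ^ N * (\<Prod>j\<in>UNIV. real (p $ j + 1) ^ (K * N))" for p
  proof -
    define R where "R = (\<Prod>j\<in>UNIV. p $ j + 1)"
    have "p $ i + 1 \<le> R" for i
      unfolding R_def by (intro dvd_imp_le dvd_prodI) (auto intro: prod_pos)
    then have "head_sum (p + 1) j \<le> (\<Sum>i\<in>{..j}. R)" for j
      unfolding head_sum_def by (intro sum_mono) auto
    moreover have "(\<Sum>i\<in>{..j}. R) \<le> N * R" for j :: 'n
      by (auto simp: N_def intro!: mult_right_mono card_mono)
    ultimately have h: "real (head_sum (p + 1) j) \<le> real N * real R" for j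
      by (metis of_nat_le_iff of_nat_mult order_trans)
    have "norm (inverse (\<Prod>j\<in>UNIV. of_nat (head_sum (p + 1) j) powr (s $ j)))
        = (\<Prod>j\<in>UNIV. real (head_sum (p + 1) j) powr (- Re (s $ j)))"
      by (simp add: norm_inverse norm_powr_real_powr powr_minus flip: prod_norm prod_inversef)
    also have "\<dots> \<le> (\<Prod>j\<in>(UNIV::'n set). (real N * real R) ^ K)"
    proof (intro prod_mono conjI)
      fix j
      have 1: "1 \<le> real (head_sum (p + 1) j)"
        using head_sum_add_one_pos[of p j] by linarith
      have "real (head_sum (p + 1) j) powr (- Re (s $ j)) \<le> real (head_sum (p + 1) j) powr real K"
        by (intro powr_mono K 1)
      also have "\<dots> = real (head_sum (p + 1) j) ^ K"
        using 1 by (intro powr_realpow) auto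
      also have "\<dots> \<le> (real N * real R) ^ K"
        by (intro power_mono h) auto
      finally show "real (head_sum (p + 1) j) powr (- Re (s $ j)) \<le> (real N * real R) ^ K" .
    qed auto
    also have "\<dots> = (real N ^ K) ^ N * real R ^ (K * N)"
      by (simp add: N_def power_mult_distrib power_mult)
    also have "real R ^ (K * N) = (\<Prod>j\<in>UNIV. real (p $ j + 1) ^ (K * N))"
      by (simp add: R_def flip: prod_power_distrib)
    finally show ?thesis .
  qed
  then show ?thesis using that[of "(real N ^ K) ^ N" "K * N"] by simp
qed

text \<open>Sum the double series \<open>F\<close> in two ways: the row of p gives the term of
  \<open>mpb_gen\<close> at l = p + 1, the column of m is a finite sum giving
  \<open>newton_dirichlet m s\<close>. The row norms are known exactly from
  \<open>abs_newton_coeff_has_sum\<close>.\<close>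

lemma mpb_gen_has_sum:
  fixes s x :: "complex^'n::{finite,linorder}"
  assumes small: "\<And>j. tail_sum (\<chi> j. norm (x $ j)) j \<le> 1 / 4"
  shows "((\<lambda>m. newton_dirichlet m s * ((\<Prod>j\<in>UNIV. (x $ j) ^ (m $ j)) / (\<Prod>j\<in>UNIV. fact (m $ j))))
    has_sum mpb_gen s x) UNIV"
proof -
  define y where "y = (\<chi> j. norm (x $ j))"
  define V where "V = (\<lambda>p. inverse (\<Prod>j\<in>UNIV. complex_of_nat (head_sum (p + 1 :: (nat, 'n) vec) j) powr (s $ j)))"
  define F where "F = (\<lambda>(p, m). V p * (of_real (newton_coeff m p) * (\<Prod>j\<in>UNIV. x $ j ^ (m $ j) / fact (m $ j))))"
  define G where "G = (\<lambda>p. \<Prod>j\<in>UNIV. (1 - exp (- tail_sum x j)) ^ (p $ j))"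
  define H where "H = (\<lambda>p. \<Prod>j\<in>UNIV. (exp (tail_sum y j) - 1) ^ (p $ j))"
  have F_row: "((\<lambda>m. F (p, m)) has_sum (V p * G p)) UNIV" for p
    unfolding F_def G_def case_prod_conv by (intro has_sum_cmult_right newton_coeff_has_sum)
  have norm_row: "((\<lambda>m. norm (F (p, m))) has_sum (norm (V p) * H p)) UNIV" for p
    using has_sum_cmult_right[OF abs_newton_coeff_has_sum[of p y], of "norm (V p)"]
    by (simp add: F_def H_def y_def norm_mult norm_divide norm_power flip: prod_norm)
  obtain C M where "C \<ge> 0" and bound:
    "\<And>p. norm (inverse (\<Prod>j\<in>UNIV. of_nat (head_sum (p + 1) j) powr (s $ j))) \<le> C * (\<Prod>j\<in>UNIV. real (p $ j + 1) ^ M)"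
    by (rule head_sum_powr_bound[of s]) (rule that)
  have V: "norm (V p) \<le> C * (\<Prod>j\<in>UNIV. real (p $ j + 1) ^ M)" for p
    unfolding V_def by (rule bound)
  have H: "0 \<le> H p" "H p \<le> (\<Prod>j\<in>UNIV. (1 / 2) ^ (p $ j))" for p
  proof -
    \<comment> \<open>The bound 1/4 gives exp(y) - 1 \<le> 1/4 + 1/16 \<le> 1/2, so \<open>H\<close>
      decays geometrically.\<close>
    have "0 \<le> exp (tail_sum y j) - 1 \<and> exp (tail_sum y j) - 1 \<le> 1 / 2" for j
    proof -
      have y: "0 \<le> tail_sum y j" "tail_sum y j \<le> 1 / 4"
        using small[of j] by (auto simp: y_def tail_sum_def intro: sum_nonneg)
      then have "exp (tail_sum y j) \<le> 1 + tail_sum y j + (tail_sum y j)\<^sup>2"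
        by (intro exp_bound) auto
      moreover have "(tail_sum y j)\<^sup>2 \<le> (1 / 4)\<^sup>2"
        by (intro power_mono y)
      ultimately show ?thesis
        using y by (auto simp: power2_eq_square)
    qed
    then show "0 \<le> H p" "H p \<le> (\<Prod>j\<in>UNIV. (1 / 2) ^ (p $ j))"
      unfolding H_def by (auto intro!: prod_mono prod_nonneg power_mono)
  qed
  have "(\<lambda>p. norm (V p) * H p) summable_on UNIV"
  proof (rule summable_on_comparison_test)
    \<comment> \<open>The ratio 3/4 is chosen between 1/2 and 1: it absorbs the polynomial factor
      and is still summable.\<close>
    have decay: "\<forall>\<^sub>F b in sequentially. real (b + 1) ^ M * (1 / 2) ^ b \<le> (3 / 4) ^ b"
      by real_asymp
    have "summable (\<lambda>b. norm (real (b + 1) ^ M * (1 / 2) ^ b))"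
    proof (rule summable_comparison_test_ev)
      show "\<forall>\<^sub>F b in sequentially. norm (norm (real (b + 1) ^ M * (1 / 2) ^ b)) \<le> (3 / 4) ^ b"
        by (rule eventually_mono[OF decay]) (simp add: abs_mult)
    qed auto
    then have "(\<lambda>b. norm (real (b + 1) ^ M * (1 / 2) ^ b)) summable_on UNIV"
      by (subst summable_on_UNIV_nonneg_real_iff) auto
    then have "(\<lambda>p::(nat, 'n) vec. norm (\<Prod>j\<in>UNIV. real (p $ j + 1) ^ M * (1 / 2) ^ (p $ j))) summable_on UNIV"
      by (rule abs_summable_on_prod_vec)
    from abs_summable_summable[OF this]
    show "(\<lambda>p::(nat, 'n) vec. C * (\<Prod>j\<in>UNIV. real (p $ j + 1) ^ M * (1 / 2) ^ (p $ j))) summable_on UNIV"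
      by (rule summable_on_cmult_right)
    fix p
    have "norm (V p) * H p \<le> (C * (\<Prod>j\<in>UNIV. real (p $ j + 1) ^ M)) * (\<Prod>j\<in>UNIV. (1 / 2) ^ (p $ j))"
      using H V \<open>C \<ge> 0\<close> by (intro mult_mono) (auto intro!: mult_nonneg_nonneg prod_nonneg)
    then show "norm (V p) * H p \<le> C * (\<Prod>j\<in>UNIV. real (p $ j + 1) ^ M * (1 / 2) ^ (p $ j))"
      by (simp add: prod.distrib mult.assoc)
  qed (use H in auto)
  then have "(\<lambda>q. norm (F q)) summable_on (UNIV \<times> UNIV)"
    using norm_row by (intro summable_on_SigmaI[where g = "\<lambda>p. norm (V p) * H p"]) auto
  then obtain T where T: "(F has_sum T) (UNIV \<times> UNIV)"
    using abs_summable_summable has_sum_infsum by blast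
  have "((\<lambda>p. V p * G p) has_sum T) UNIV"
    using has_sum_Sigma'[OF T F_row] by simp
  also have "?this \<longleftrightarrow> ((\<lambda>l. (\<Prod>j\<in>UNIV. (1 - exp (- tail_sum x j)) ^ (l $ j - 1)) /
     (\<Prod>j\<in>UNIV. of_nat (head_sum l j) powr (s $ j))) has_sum T) pos_tuples"
    by (rule has_sum_reindex_bij_witness[where j = "\<lambda>p. p + 1" and i = "\<lambda>l. l - 1"])
      (auto simp: pos_tuples_def vec_eq_iff Suc_le_eq V_def G_def divide_inverse mult.commute)
  finally have T_eq: "mpb_gen s x = T"
    unfolding mpb_gen_def by (rule infsumI)
  have column: "((\<lambda>p. F (p, m)) has_sum (newton_dirichlet m s * ((\<Prod>j\<in>UNIV. (x $ j) ^ (m $ j)) / (\<Prod>j\<in>UNIV. fact (m $ j))))) UNIV" for m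
  proof (rule has_sum_finite_neutralI)
    show "finite {p::(nat, 'n) vec. \<forall>j. p $ j \<le> tail_sum m j}" by (rule finite_vec_atMost)
    show "F (p, m) = 0" if "p \<in> UNIV - {p. \<forall>j. p $ j \<le> tail_sum m j}" for p
      using that newton_coeff_eq_0[of m _ p] by (auto simp: F_def not_le)
    show "newton_dirichlet m s * ((\<Prod>j\<in>UNIV. (x $ j) ^ (m $ j)) / (\<Prod>j\<in>UNIV. fact (m $ j)))
        = (\<Sum>p | \<forall>j. p $ j \<le> tail_sum m j. F (p, m))"
      unfolding newton_dirichlet_def F_def V_def case_prod_conv prod_dividef sum_distrib_right
      by (intro sum.cong refl) (simp add: divide_inverse mult_ac)
  qed auto
  have "((\<lambda>(m, p). F (p, m)) has_sum T) (UNIV \<times> UNIV)"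
    using T by (rule iffD1[OF has_sum_swap])
  then have "((\<lambda>m. newton_dirichlet m s * ((\<Prod>j\<in>UNIV. (x $ j) ^ (m $ j)) / (\<Prod>j\<in>UNIV. fact (m $ j)))) has_sum T) UNIV"
    by (rule has_sum_Sigma') (simp only: case_prod_conv column)
  then show ?thesis unfolding T_eq .
qed

lemma eventually_tail_sum_less:
  assumes "0 < \<epsilon>"
  shows "\<forall>\<^sub>F x :: complex^'n::{finite,linorder} in nhds 0. \<forall>j. tail_sum (\<chi> j. norm (x $ j)) j < \<epsilon>"
proof (intro eventually_all_finite)
  fix j :: 'n
  have "((\<lambda>x :: (complex, 'n) vec. tail_sum (\<chi> j. norm (x $ j)) j) \<longlongrightarrow> tail_sum (\<chi> j. norm ((0 :: (complex, 'n) vec) $ j)) j) (nhds 0)"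
    unfolding tail_sum_def vec_lambda_beta by (intro tendsto_intros filterlim_ident)
  then show "\<forall>\<^sub>F x :: (complex, 'n) vec in nhds 0. tail_sum (\<chi> j. norm (x $ j)) j < \<epsilon>"
    by (rule order_tendstoD) (simp add: tail_sum_def assms)
qed

text \<open>The description in \<open>mpb\<close> is satisfied by \<open>mpb_gen_has_sum\<close>; it
  determines the coefficients because the difference of two such expansions is a power series
  summing to 0 near 0.\<close>

lemma mpb_eq_newton_dirichlet:
  fixes s :: "complex^'n::{finite,linorder}"
  shows "mpb s k = newton_dirichlet k s"
proof -
  define P where "P = (\<lambda>b. \<forall>\<^sub>F x in nhds 0. (\<forall>j. norm (1 - exp (- tail_sum x j)) < 1) \<longrightarrow>
     ((\<lambda>m. b m * ((\<Prod>j\<in>UNIV. (x $ j) ^ (m $ j)) / (\<Prod>j\<in>UNIV. fact (m $ j))))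
        has_sum mpb_gen s x) UNIV)"
  have small: "\<forall>\<^sub>F x :: (complex, 'n) vec in nhds 0. \<forall>j. tail_sum (\<chi> j. norm (x $ j)) j \<le> 1 / 4"
    by (rule eventually_mono[OF eventually_tail_sum_less[of "1 / 4"]]) (auto intro: less_imp_le)
  \<comment> \<open>The guard in \<open>mpb\<close> holds near 0, so that every candidate
    \<open>b\<close> really provides an expansion there.\<close>
  have conv: "\<forall>\<^sub>F x :: (complex, 'n) vec in nhds 0. \<forall>j. norm (1 - exp (- tail_sum x j)) < 1"
  proof (intro eventually_all_finite)
    fix j :: 'n
    have "((\<lambda>x :: (complex, 'n) vec. norm (1 - exp (- tail_sum x j))) \<longlongrightarrow> norm (1 - exp (- tail_sum (0 :: (complex, 'n) vec) j))) (nhds 0)"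
      unfolding tail_sum_def by (intro tendsto_intros filterlim_ident)
    then show "\<forall>\<^sub>F x :: (complex, 'n) vec in nhds 0. norm (1 - exp (- tail_sum x j)) < 1"
      by (rule order_tendstoD) (simp add: tail_sum_def)
  qed
  have ex: "P (\<lambda>m. newton_dirichlet m s)"
    unfolding P_def using small by (rule eventually_mono) (intro impI mpb_gen_has_sum, blast)
  have "b = (\<lambda>m. newton_dirichlet m s)" if "P b" for b
  proof
    fix m
    have "\<forall>\<^sub>F x in nhds 0. ((\<lambda>m. (b m - newton_dirichlet m s) / (\<Prod>j\<in>UNIV. fact (m $ j)) * (\<Prod>j\<in>UNIV. (x $ j) ^ (m $ j)))
        has_sum 0) UNIV"
      using ex that conv unfolding P_def
    proof eventually_elim
      case (elim x)
      let ?M = "\<lambda>m. (\<Prod>j\<in>UNIV. (x $ j) ^ (m $ j)) / (\<Prod>j\<in>UNIV. fact (m $ j))"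
      have "((\<lambda>m. b m * ?M m + (-1) * (newton_dirichlet m s * ?M m)) has_sum (mpb_gen s x + (-1) * mpb_gen s x)) UNIV"
        using elim by (intro has_sum_add has_sum_cmult_right) auto
      then show ?case by (simp add: algebra_simps diff_divide_distrib)
    qed
    then have "(b m - newton_dirichlet m s) / (\<Prod>j\<in>UNIV. fact (m $ j)) = 0"
      by (rule has_sum_0_imp_coeff_eq_0)
    then show "b m = newton_dirichlet m s" by simp
  qed
  with ex have "(THE b. P b) = (\<lambda>m. newton_dirichlet m s)"
    by (rule the_equality)
  then show ?thesis by (simp add: mpb_def P_def)
qed

subsection \<open>The rational continuation of the series at non-positive integers\<close>

text \<open>The binomial series with exponent -(p+1) at -z. Absolute convergence follows from the
  same series at the real point |z|.\<close>

lemma negative_binomial_has_sum: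
  fixes z :: complex
  assumes "norm z < 1"
  shows "((\<lambda>l. of_nat (l + p choose p) * z ^ l) has_sum (1 / (1 - z) ^ (p + 1))) UNIV"
    and "(\<lambda>l. norm (of_nat (l + p choose p) * z ^ l)) summable_on UNIV"
proof -
  have sums: "(\<lambda>l. of_nat (l + p choose p) * w ^ l) sums (1 / (1 - w) ^ (p + 1))" if "norm w < 1" for w :: complex
  proof -
    have "(- of_nat (p + 1) gchoose l) * (- w) ^ l = of_nat (l + p choose p) * w ^ l" for l
    proof -
      have "(- of_nat (p + 1) gchoose l) = (-1) ^ l * ((of_nat (l + p) :: complex) gchoose l)"
        by (subst gbinomial_minus) (simp add: add_ac)
      also have "\<dots> = (-1) ^ l * of_nat (l + p choose p)"
        using binomial_symmetric[of l "l + p"] binomial_gbinomial[of "l + p" l, where 'a = complex] by simp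
      finally have "(- of_nat (p + 1) gchoose l) * (- w) ^ l = of_nat (l + p choose p) * ((-1) ^ l * (- w) ^ l)"
        by simp
      also have "(-1) ^ l * (- w) ^ l = w ^ l"
        by (simp flip: power_mult_distrib)
      finally show ?thesis .
    qed
    moreover have "(1 + - w) powr (- of_nat (p + 1)) = 1 / (1 - w) ^ (p + 1)"
    proof -
      have "1 - w \<noteq> 0" using that by auto
      then show ?thesis using powr_complexpow[of "1 - w" "p + 1"]
        by (simp only: powr_minus) (simp add: divide_inverse)
    qed
    ultimately show ?thesis
      using gen_binomial_complex[of "- w" "- of_nat (p + 1)"] that by simp
  qed
  have "summable (\<lambda>l. Re (of_nat (l + p choose p) * complex_of_real (norm z) ^ l))"
    using sums[of "of_real (norm z)"] assms by (intro summable_Re) (simp add: sums_iff)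
  also have "(\<lambda>l. Re (of_nat (l + p choose p) * complex_of_real (norm z) ^ l))
      = (\<lambda>l. norm (of_nat (l + p choose p) * z ^ l))"
    by (simp add: norm_mult norm_power flip: of_real_power)
  finally have summable: "summable (\<lambda>l. norm (of_nat (l + p choose p) * z ^ l))" .
  then show "((\<lambda>l. of_nat (l + p choose p) * z ^ l) has_sum (1 / (1 - z) ^ (p + 1))) UNIV"
    by (rule norm_summable_imp_has_sum) (rule sums[OF assms])
  show "(\<lambda>l. norm (of_nat (l + p choose p) * z ^ l)) summable_on UNIV"
    using summable by (subst summable_on_UNIV_nonneg_real_iff) auto
qed

text \<open>Write l as 1 plus a vector over all naturals, apply \<open>newton_expansion\<close> to
  the numerators and sum each coordinate by the negative binomial series. The shift by 1 produces
  the factor \<open>Z\<close>.\<close>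

lemma Li_sh_minus_of_nat:
  fixes k :: "nat^'n::{finite,linorder}" and z :: "complex^'n::{finite,linorder}"
  assumes z: "\<And>j. norm (z $ j) < 1"
  shows "Li_sh (\<chi> j. - of_nat (k $ j)) z = (\<Sum>p\<in>{p. \<forall>j. p $ j \<le> tail_sum k j}.
    of_real (newton_coeff k p) * (\<Prod>j\<in>UNIV. z $ j / (1 - z $ j) ^ (p $ j + 1)))"
proof -
  define B where "B = {p. \<forall>j. p $ j \<le> tail_sum k j}"
  define Z where "Z = (\<Prod>j\<in>UNIV. z $ j)"
  have prod: "((\<lambda>l. \<Prod>j\<in>UNIV. of_nat (l $ j + p $ j choose p $ j) * z $ j ^ (l $ j))
      has_sum (\<Prod>j\<in>UNIV. 1 / (1 - z $ j) ^ (p $ j + 1))) UNIV" for p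
    by (rule has_sum_prod_vec[where f = "\<lambda>j b. of_nat (b + p $ j choose p $ j) * z $ j ^ b"])
      (rule negative_binomial_has_sum z)+
  have finB: "finite B" unfolding B_def by (rule finite_vec_atMost)
  have "((\<lambda>l. Z * (\<Sum>p\<in>B. of_real (newton_coeff k p) *
         (\<Prod>j\<in>UNIV. of_nat (l $ j + p $ j choose p $ j) * z $ j ^ (l $ j))))
      has_sum (Z * (\<Sum>p\<in>B. of_real (newton_coeff k p) * (\<Prod>j\<in>UNIV. 1 / (1 - z $ j) ^ (p $ j + 1))))) UNIV"
    by (intro has_sum_cmult_right has_sum_finite_sum finB prod)
  also have "Z * (\<Sum>p\<in>B. of_real (newton_coeff k p) * (\<Prod>j\<in>UNIV. 1 / (1 - z $ j) ^ (p $ j + 1)))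
     = (\<Sum>p\<in>B. of_real (newton_coeff k p) * (\<Prod>j\<in>UNIV. z $ j / (1 - z $ j) ^ (p $ j + 1)))"
    unfolding Z_def sum_distrib_left prod_dividef by (intro sum.cong refl) simp
  also have "(\<lambda>l. Z * (\<Sum>p\<in>B. of_real (newton_coeff k p) *
         (\<Prod>j\<in>UNIV. of_nat (l $ j + p $ j choose p $ j) * z $ j ^ (l $ j))))
     = (\<lambda>l. (\<Prod>j\<in>UNIV. z $ j ^ (l $ j + 1)) / (\<Prod>j\<in>UNIV. of_nat (head_sum (l + 1) j) powr (- of_nat (k $ j))))"
  proof
    fix l
    have "of_nat (head_sum (l + 1) j) powr (- of_nat (k $ j)) = inverse (of_real (real (head_sum (l + 1) j)) ^ (k $ j) :: complex)" for j
      using head_sum_add_one_pos[of l j] by (simp add: powr_minus)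
    then have "inverse (\<Prod>j\<in>UNIV. of_nat (head_sum (l + 1) j) powr (- of_nat (k $ j)))
        = complex_of_real (\<Prod>j\<in>UNIV. real (head_sum (l + 1) j) ^ (k $ j))"
      by (simp flip: prod_inversef)
    also have "\<dots> = (\<Sum>p\<in>B. of_real (newton_coeff k p) * (\<Prod>j\<in>UNIV. of_nat (l $ j + p $ j choose p $ j)))"
      unfolding newton_expansion B_def by simp
    finally show "Z * (\<Sum>p\<in>B. of_real (newton_coeff k p) *
         (\<Prod>j\<in>UNIV. of_nat (l $ j + p $ j choose p $ j) * z $ j ^ (l $ j)))
      = (\<Prod>j\<in>UNIV. z $ j ^ (l $ j + 1)) / (\<Prod>j\<in>UNIV. of_nat (head_sum (l + 1) j) powr (- of_nat (k $ j)))"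
      by (simp add: divide_inverse Z_def prod.distrib sum_distrib_left mult_ac)
  qed
  finally have "((\<lambda>l. (\<Prod>j\<in>UNIV. z $ j ^ (l $ j + 1)) / (\<Prod>j\<in>UNIV. of_nat (head_sum (l + 1) j) powr (- of_nat (k $ j))))
      has_sum (\<Sum>p\<in>B. of_real (newton_coeff k p) * (\<Prod>j\<in>UNIV. z $ j / (1 - z $ j) ^ (p $ j + 1)))) UNIV" .
  also have "?this \<longleftrightarrow> ((\<lambda>l. (\<Prod>j\<in>UNIV. (z $ j) ^ (l $ j)) /
        (\<Prod>j\<in>UNIV. of_nat (head_sum l j) powr ((\<chi> j. - of_nat (k $ j)) $ j)))
      has_sum (\<Sum>p\<in>B. of_real (newton_coeff k p) * (\<Prod>j\<in>UNIV. z $ j / (1 - z $ j) ^ (p $ j + 1)))) pos_tuples"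
    by (rule has_sum_reindex_bij_witness[where j = "\<lambda>p. p + 1" and i = "\<lambda>l. l - 1"])
      (auto simp: pos_tuples_def vec_eq_iff Suc_le_eq)
  finally show ?thesis
    unfolding Li_sh_def B_def by (rule infsumI)
qed

section \<open>Polynomial functions and their identity theorem\<close>

text \<open>The exponent map \<open>e\<close> may repeat values; terms with equal exponents are
  collected. This yields closure under sums and products.\<close>

lemma mpoly_funI:
  fixes P :: "complex^'n \<Rightarrow> complex"
  assumes "finite I" and P: "\<And>z. P z = (\<Sum>i\<in>I. c i * (\<Prod>j\<in>UNIV. (z $ j) ^ (e i $ j)))"
  shows "mpoly_fun P"
  unfolding mpoly_fun_def
proof (intro exI conjI allI)
  show "finite (e ` I)" using assms by simp
  fix z
  show "P z = (\<Sum>m\<in>e ` I. (\<Sum>i\<in>{i \<in> I. e i = m}. c i) * (\<Prod>j\<in>UNIV. (z $ j) ^ (m $ j)))"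
    unfolding P by (subst sum.image_gen[OF \<open>finite I\<close>, of _ e]) (simp add: sum_distrib_right)
qed

lemma mpoly_fun_const: "mpoly_fun (\<lambda>_. c)"
  by (rule mpoly_funI[where I = "{()}" and c = "\<lambda>_. c" and e = "\<lambda>_. 0"]) auto

lemma mpoly_fun_nth: "mpoly_fun (\<lambda>z. z $ i)"
proof (rule mpoly_funI[where I = "{()}" and c = "\<lambda>_. 1" and e = "\<lambda>_. axis i 1"])
  show "z $ i = (\<Sum>_\<in>{()}. 1 * (\<Prod>j\<in>UNIV. z $ j ^ (axis i 1 $ j)))" for z :: "complex^'a"
    using prod_power_add_axis[of "($) z" 0 i] by simp
qed auto

lemma mpoly_fun_add:
  assumes "mpoly_fun P" "mpoly_fun Q"
  shows "mpoly_fun (\<lambda>z. P z + Q z)"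
proof -
  obtain M c where "finite M" and P: "\<And>z. P z = (\<Sum>m\<in>M. c m * (\<Prod>j\<in>UNIV. (z $ j) ^ (m $ j)))"
    using assms(1) unfolding mpoly_fun_def by blast
  obtain N d where "finite N" and Q: "\<And>z. Q z = (\<Sum>m\<in>N. d m * (\<Prod>j\<in>UNIV. (z $ j) ^ (m $ j)))"
    using assms(2) unfolding mpoly_fun_def by blast
  show ?thesis
    using \<open>finite M\<close> \<open>finite N\<close>
    by (intro mpoly_funI[where I = "M <+> N" and c = "case_sum c d" and e = "case_sum id id"])
      (auto simp: P Q sum.Plus)
qed

lemma mpoly_fun_mult:
  assumes "mpoly_fun P" "mpoly_fun Q"
  shows "mpoly_fun (\<lambda>z. P z * Q z)"
proof -
  obtain M c where "finite M" and P: "\<And>z. P z = (\<Sum>m\<in>M. c m * (\<Prod>j\<in>UNIV. (z $ j) ^ (m $ j)))"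
    using assms(1) unfolding mpoly_fun_def by blast
  obtain N d where "finite N" and Q: "\<And>z. Q z = (\<Sum>m\<in>N. d m * (\<Prod>j\<in>UNIV. (z $ j) ^ (m $ j)))"
    using assms(2) unfolding mpoly_fun_def by blast
  show ?thesis
    using \<open>finite M\<close> \<open>finite N\<close>
    by (intro mpoly_funI[where I = "M \<times> N" and c = "\<lambda>(m, n). c m * d n" and e = "\<lambda>(m, n). m + n"])
      (auto simp: P Q sum_product sum.cartesian_product power_add prod.distrib mult_ac intro!: sum.cong)
qed

lemma mpoly_fun_sum: "(\<And>i. i \<in> I \<Longrightarrow> mpoly_fun (P i)) \<Longrightarrow> mpoly_fun (\<lambda>z. \<Sum>i\<in>I. P i z)"
  by (induction I rule: infinite_finite_induct) (auto intro: mpoly_fun_const mpoly_fun_add)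

lemma mpoly_fun_prod: "(\<And>i. i \<in> I \<Longrightarrow> mpoly_fun (P i)) \<Longrightarrow> mpoly_fun (\<lambda>z. \<Prod>i\<in>I. P i z)"
  by (induction I rule: infinite_finite_induct) (auto intro: mpoly_fun_const mpoly_fun_mult)

lemma mpoly_fun_power: "mpoly_fun P \<Longrightarrow> mpoly_fun (\<lambda>z. P z ^ n)"
  by (induction n) (auto intro: mpoly_fun_const mpoly_fun_mult)

lemma mpoly_fun_diff: "mpoly_fun P \<Longrightarrow> mpoly_fun Q \<Longrightarrow> mpoly_fun (\<lambda>z. P z - Q z)"
  using mpoly_fun_add[OF _ mpoly_fun_mult[OF mpoly_fun_const[of "-1"]], of P Q] by simp

lemma mpoly_fun_holomorphic_line:
  assumes "mpoly_fun P"
  shows "(\<lambda>w. P (w *s z)) holomorphic_on A"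
proof -
  obtain M c where P: "\<And>z. P z = (\<Sum>m\<in>M. c m * (\<Prod>j\<in>UNIV. (z $ j) ^ (m $ j)))"
    using assms unfolding mpoly_fun_def by blast
  show ?thesis
    unfolding P vector_smult_component by (intro holomorphic_intros)
qed

text \<open>On the complex line through \<open>z\<close> both sides are entire in \<open>w\<close>
  and agree for small \<open>w\<close>. The radius 1 / (1 + |z|) keeps w z inside the unit
  polydisc.\<close>

lemma mpoly_fun_eqI:
  fixes P Q :: "complex^'n \<Rightarrow> complex"
  assumes "mpoly_fun P" "mpoly_fun Q"
    and eq: "\<And>z. (\<And>j. norm (z $ j) < 1) \<Longrightarrow> P z = Q z"
  shows "P = Q"
proof
  fix z :: "complex^'n"
  define r where "r = 1 / (1 + norm z)"
  have "0 < r" unfolding r_def by (simp add: add_pos_nonneg)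
  have "P (1 *s z) = Q (1 *s z)"
  proof (rule analytic_continuation_open[of "ball 0 r" UNIV "\<lambda>w. P (w *s z)" "\<lambda>w. Q (w *s z)"])
    fix w :: complex assume "w \<in> ball 0 r"
    show "P (w *s z) = Q (w *s z)"
    proof (rule eq)
      fix j
      have "norm ((w *s z) $ j) \<le> norm w * norm z"
        by (simp add: norm_mult mult_left_mono Finite_Cartesian_Product.norm_nth_le)
      also have "\<dots> \<le> r * norm z"
        using \<open>w \<in> ball 0 r\<close> by (intro mult_right_mono) auto
      also have "\<dots> < 1"
        by (simp add: r_def divide_less_eq add_pos_nonneg)
      finally show "norm ((w *s z) $ j) < 1" .
    qed
  qed (use \<open>0 < r\<close> assms mpoly_fun_holomorphic_line in auto)
  then show "P z = Q z" by simp
qed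

lemma Li_sh_neg_eq:
  fixes k :: "nat^'n::{finite,linorder}" and z :: "complex^'n::{finite,linorder}"
  assumes "\<And>j. z $ j \<noteq> 1"
  shows "Li_sh_neg k z = (\<Sum>p\<in>{p. \<forall>j. p $ j \<le> tail_sum k j}.
    of_real (newton_coeff k p) * (\<Prod>j\<in>UNIV. z $ j / (1 - z $ j) ^ (p $ j + 1)))"
proof -
  define B where "B = {p. \<forall>j. p $ j \<le> tail_sum k j}"
  \<comment> \<open>The finite sum for the series brought to the common denominator; on
    \<open>B\<close> the subtraction \<open>tail_sum k j - p $ j\<close> is exact.\<close>
  define Q where "Q = (\<lambda>z::(complex, 'n) vec. \<Sum>p\<in>B. of_real (newton_coeff k p) *
    (\<Prod>j\<in>UNIV. z $ j * (1 - z $ j) ^ (tail_sum k j - p $ j)))"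
  define R where "R = (\<lambda>P. mpoly_fun P \<and> (\<forall>z. (\<forall>j. norm (z $ j) < 1) \<longrightarrow>
        Li_sh (\<chi> j. - of_nat (k $ j)) z = P z / Li_sh_neg_den k z))"
  have Q_div: "Q z / Li_sh_neg_den k z = (\<Sum>p\<in>B.
      of_real (newton_coeff k p) * (\<Prod>j\<in>UNIV. z $ j / (1 - z $ j) ^ (p $ j + 1)))" if "\<And>j. z $ j \<noteq> 1" for z :: "(complex, 'n) vec"
    unfolding Q_def sum_divide_distrib
  proof (intro sum.cong refl)
    fix p assume p: "p \<in> B"
    have "z $ j * (1 - z $ j) ^ (tail_sum k j - p $ j) / (1 - z $ j) ^ (tail_sum k j + 1)
        = z $ j / (1 - z $ j) ^ (p $ j + 1)" for j
    proof -
      have "tail_sum k j + 1 = (tail_sum k j - p $ j) + (p $ j + 1)"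
        using p by (simp add: B_def)
      then show ?thesis
        using that[of j] by (simp only: power_add) (simp add: field_simps)
    qed
    then show "of_real (newton_coeff k p) * (\<Prod>j\<in>UNIV. z $ j * (1 - z $ j) ^ (tail_sum k j - p $ j)) / Li_sh_neg_den k z
       = of_real (newton_coeff k p) * (\<Prod>j\<in>UNIV. z $ j / (1 - z $ j) ^ (p $ j + 1))"
      unfolding Li_sh_neg_den_def times_divide_eq_right[symmetric] prod_dividef[symmetric] by simp
  qed
  have "R Q"
    unfolding R_def
  proof (intro conjI allI impI)
    show "mpoly_fun Q"
      unfolding Q_def
      by (intro mpoly_fun_sum mpoly_fun_mult mpoly_fun_prod mpoly_fun_power mpoly_fun_diff mpoly_fun_const mpoly_fun_nth)
    fix z :: "(complex, 'n) vec" assume z: "\<forall>j. norm (z $ j) < 1"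
    then have "z $ j \<noteq> 1" for j by (metis less_irrefl norm_one)
    from Q_div[OF this] show "Li_sh (\<chi> j. - of_nat (k $ j)) z = Q z / Li_sh_neg_den k z"
      using Li_sh_minus_of_nat[OF spec[OF z], of k] unfolding B_def by metis
  qed
  have "P = Q" if "R P" for P
  proof (rule mpoly_fun_eqI)
    fix z :: "(complex, 'n) vec" assume z: "\<And>j. norm (z $ j) < 1"
    then have "1 - z $ j \<noteq> 0" for j by (metis less_irrefl norm_one right_minus_eq)
    then have "Li_sh_neg_den k z \<noteq> 0" by (simp add: Li_sh_neg_den_def)
    moreover have "P z / Li_sh_neg_den k z = Q z / Li_sh_neg_den k z"
      using \<open>R P\<close> \<open>R Q\<close> z unfolding R_def by metis
    ultimately show "P z = Q z" by simp
  qed (use \<open>R P\<close> \<open>R Q\<close> in \<open>auto simp: R_def\<close>)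
  with \<open>R Q\<close> have "(THE P. R P) = Q" by (rule the_equality)
  then have "Li_sh_neg_num k = Q" by (simp add: Li_sh_neg_num_def R_def)
  then show ?thesis
    using Q_div[OF assms] by (simp add: Li_sh_neg_def B_def)
qed

subsection \<open>The integral and its continuation\<close>

lemma inj_axis_one: "inj (\<lambda>j. axis j (1::real))"
  by (auto simp: inj_def axis_eq_axis)

lemma Basis_real_vec: "(Basis :: (real^'n::finite) set) = range (\<lambda>j. axis j 1)"
  by (auto simp: Basis_vec_def)

text \<open>Lebesgue measure on vectors is the image of the product measure over the basis, so
  Fubini for products applies once each factor is attached to its basis vector, as \<open>g\<close>
  does.\<close>

lemma
  fixes f :: "'n::finite \<Rightarrow> real \<Rightarrow> 'a::{real_normed_field,banach,second_countable_topology}"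
  assumes f: "\<And>j. integrable lborel (f j)"
  shows integrable_lborel_prod_vec: "integrable lborel (\<lambda>t::real^'n. \<Prod>j\<in>UNIV. f j (t $ j))"
    and integral_lborel_prod_vec:
      "integral\<^sup>L lborel (\<lambda>t::real^'n. \<Prod>j\<in>UNIV. f j (t $ j)) = (\<Prod>j\<in>UNIV. integral\<^sup>L lborel (f j))"
proof -
  interpret product_sigma_finite "\<lambda>_::real^'n. lborel :: real measure"
    by unfold_locales
  define g where "g = (\<lambda>b. f (inv (\<lambda>j. axis j (1::real)) b))"
  have prod_Basis: "(\<Prod>b\<in>Basis. h b) = (\<Prod>j\<in>UNIV. h (axis j 1))" for h :: "real^'n \<Rightarrow> 'a"
    unfolding Basis_real_vec by (simp add: prod.reindex[OF inj_axis_one])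
  have g: "g (axis j 1) = f j" for j
    by (simp add: g_def inv_f_f[OF inj_axis_one])
  have nth: "(\<Sum>b\<in>(Basis :: (real^'n) set). x b *\<^sub>R b) $ j = x (axis j 1)" for x j
  proof -
    have "axis i (1::real) $ j = (if i = j then 1 else 0)" for i
      by (simp add: axis_def)
    then show ?thesis
      unfolding Basis_real_vec
      by (simp add: sum.reindex[OF inj_axis_one] if_distrib[of "\<lambda>y. _ * y"] cong: if_cong)
  qed
  have g_int: "integrable lborel (g b)" for b
    unfolding g_def by (rule f)
  have [measurable]: "f j \<in> borel_measurable borel" for j
    using borel_measurable_integrable[OF f[of j]] by simp
  have meas: "(\<lambda>t::real^'n. \<Prod>j\<in>UNIV. f j (t $ j)) \<in> borel_measurable borel"
    by measurable
  have emb: "(\<lambda>x. \<Sum>b\<in>(Basis :: (real^'n) set). x b *\<^sub>R b) \<in> measurable (\<Pi>\<^sub>M b\<in>Basis. lborel) borel"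
    by measurable
  have eq: "(\<Prod>j\<in>UNIV. f j ((\<Sum>b\<in>(Basis :: (real^'n) set). x b *\<^sub>R b) $ j)) = (\<Prod>b\<in>Basis. g b (x b))" for x
    unfolding prod_Basis nth g ..
  show "integrable lborel (\<lambda>t::real^'n. \<Prod>j\<in>UNIV. f j (t $ j))"
    unfolding lborel_eq[where 'a = "real^'n"] integrable_distr_eq[OF emb meas] eq
    by (intro product_integrable_prod g_int) auto
  show "integral\<^sup>L lborel (\<lambda>t::real^'n. \<Prod>j\<in>UNIV. f j (t $ j)) = (\<Prod>j\<in>UNIV. integral\<^sup>L lborel (f j))"
    unfolding lborel_eq[where 'a = "real^'n"] integral_distr[OF emb meas] eq
    by (subst product_integral_prod) (auto simp: g_int prod_Basis g)
qed

text \<open>Substitute a t in Euler's integral: the power contributes a^(s-1) and the Jacobian one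
  more factor a.\<close>

lemma
  fixes s :: complex
  assumes "0 < Re s" "0 < a"
  defines "f \<equiv> \<lambda>t. indicator {0<..} t *\<^sub>R (complex_of_real t powr (s - 1) * of_real (exp (- a * t)))"
  shows integrable_Gamma_scaled: "integrable lborel f"
    and integral_Gamma_scaled: "(LINT t|lborel. f t) = Gamma s / of_real a powr s"
proof -
  define g where "g = (\<lambda>t. indicator {0<..} t *\<^sub>R (complex_of_real t powr (s - 1) / of_real (exp t)))"
  have "continuous_on {0<..} (\<lambda>t. complex_of_real t powr (s - 1) / of_real (exp t))"
    by (intro continuous_intros) auto
  then have meas: "g \<in> borel_measurable borel"
    unfolding g_def by (intro borel_measurable_continuous_on_indicator) auto
  have abs: "(\<lambda>t. complex_of_real t powr (s - 1) / of_real (exp t)) absolutely_integrable_on {0<..}"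
    by (rule absolutely_integrable_Gamma_integral'[OF assms(1)])
  \<comment> \<open>Euler's integral is known for the completed measure; Borel measurability of
    \<open>g\<close> transfers it to \<open>lborel\<close>.\<close>
  have g_int: "integrable lborel g"
    using abs meas unfolding set_integrable_def g_def by (simp add: integrable_completion)
  have "(LINT t|lborel. g t) = (LINT t|lebesgue. g t)"
    using meas by (simp add: integral_completion)
  also have "\<dots> = integral {0<..} (\<lambda>t. complex_of_real t powr (s - 1) / of_real (exp t))"
    using set_lebesgue_integral_eq_integral(2)[OF abs] by (simp add: set_lebesgue_integral_def g_def)
  also have "\<dots> = Gamma s"
    using Gamma_integral_complex'[OF assms(1)] by (rule integral_unique)
  finally have g_val: "(LINT t|lborel. g t) = Gamma s" .
  have scale: "g (0 + a * t) = of_real a powr (s - 1) * f t" for t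
    using \<open>0 < a\<close> by (auto simp: g_def f_def indicator_def zero_less_mult_iff powr_times_real exp_minus divide_inverse)
  have a: "complex_of_real a powr (s - 1) \<noteq> 0" using \<open>0 < a\<close> by simp
  have "integrable lborel (\<lambda>t. of_real a powr (s - 1) * f t)"
    using lborel_integrable_real_affine[OF g_int, of a 0] \<open>0 < a\<close> unfolding scale by simp
  from integrable_mult_right[OF this, of "inverse (of_real a powr (s - 1))"]
  show "integrable lborel f"
    using a by (simp flip: mult.assoc)
  have "Gamma s = of_real a * (of_real a powr (s - 1) * (LINT t|lborel. f t))"
    using lborel_integral_real_affine[of a g 0] \<open>0 < a\<close> unfolding scale g_val
    by (simp add: scaleR_conv_of_real)
  also have "\<dots> = of_real a powr s * (LINT t|lborel. f t)"
    using \<open>0 < a\<close> by (simp add: powr_diff)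
  finally show "(LINT t|lborel. f t) = Gamma s / of_real a powr s"
    using \<open>0 < a\<close> by (simp add: field_simps)
qed

text \<open>Here 1 - z_j = exp(T_j), and dividing by the product of the z_j cancels the numerators
  in \<open>Li_sh_neg_eq\<close>. What remains are products of exp(-(p_j+1) T_j), which the
  head-tail duality separates into scaled Gamma integrals.\<close>

lemma eta_neg_integral_eq_newton_dirichlet:
  fixes k :: "nat^'n::{finite,linorder}" and s :: "complex^'n::{finite,linorder}"
  assumes s: "\<And>j. 0 < Re (s $ j)"
  shows "eta_neg_integral k s = newton_dirichlet k s"
proof -
  define B where "B = {p. \<forall>j. p $ j \<le> tail_sum k j}"
  define f where "f = (\<lambda>(p::(nat, 'n) vec) j x. indicator {0<..} x *\<^sub>R
    (complex_of_real x powr (s $ j - 1) * of_real (exp (- real (head_sum (p + 1) j) * x))))"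
  have integrand: "indicator {t. \<forall>j. 0 < t $ j} t *\<^sub>R
        ((\<Prod>j\<in>UNIV. complex_of_real (t $ j) powr (s $ j - 1)) *
        (Li_sh_neg k (\<chi> j. complex_of_real (1 - exp (tail_sum t j))) /
         (\<Prod>j\<in>UNIV. complex_of_real (1 - exp (tail_sum t j)))))
      = (\<Sum>p\<in>B. of_real (newton_coeff k p) * (\<Prod>j\<in>UNIV. f p j (t $ j)))" for t :: "(real, 'n) vec"
  proof (cases "\<forall>j. 0 < t $ j")
    case False
    then obtain i where "\<not> 0 < t $ i" by blast
    then have "(\<Prod>j\<in>UNIV. f p j (t $ j)) = 0" for p
      by (intro prod_zero) (auto simp: f_def intro!: exI[of _ i])
    then have "(\<Sum>p\<in>B. of_real (newton_coeff k p) * (\<Prod>j\<in>UNIV. f p j (t $ j))) = 0"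
      by (simp only: mult_zero_right sum.neutral_const)
    then show ?thesis using False by simp
  next
    case True
    define z where "z = (\<chi> j. complex_of_real (1 - exp (tail_sum t j)))"
    have T: "0 < tail_sum t j" for j
      unfolding tail_sum_def using True by (intro sum_pos) auto
    have z0: "z $ j \<noteq> 0" and z1: "z $ j \<noteq> 1" for j
      using T[of j] by (auto simp: z_def complex_eq_iff)
    have quot: "Li_sh_neg k z / (\<Prod>j\<in>UNIV. z $ j)
        = (\<Sum>p\<in>B. of_real (newton_coeff k p) * (\<Prod>j\<in>UNIV. 1 / (1 - z $ j) ^ (p $ j + 1)))"
      unfolding Li_sh_neg_eq[OF z1] B_def sum_divide_distrib times_divide_eq_right[symmetric] prod_dividef[symmetric]
      using z0 by (intro sum.cong) auto
    have expo: "(\<Prod>j\<in>UNIV. 1 / (1 - z $ j) ^ (p $ j + 1))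
        = (\<Prod>j\<in>UNIV. complex_of_real (exp (- real (head_sum (p + 1) j) * t $ j)))" for p
    proof -
      have "(\<Prod>j\<in>UNIV. 1 / (1 - z $ j) ^ (p $ j + 1)) = of_real (\<Prod>j\<in>UNIV. exp (- (real ((p + 1) $ j) * tail_sum t j)))"
        unfolding of_real_prod
      proof (intro prod.cong refl)
        fix j
        have "exp (- (real ((p + 1) $ j) * tail_sum t j)) = 1 / exp (tail_sum t j) ^ (p $ j + 1)"
          using exp_of_nat_mult[of "(p + 1) $ j" "tail_sum t j"]
          by (simp add: exp_minus divide_inverse)
        then show "1 / (1 - z $ j) ^ (p $ j + 1) = complex_of_real (exp (- (real ((p + 1) $ j) * tail_sum t j)))"
          by (simp add: z_def)
      qed
      also have "(\<Prod>j\<in>UNIV. exp (- (real ((p + 1) $ j) * tail_sum t j))) = exp (- (\<Sum>j\<in>UNIV. real ((p + 1) $ j) * tail_sum t j))"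
        by (simp only: exp_sum[symmetric] finite sum_negf[symmetric])
      also have "\<dots> = (\<Prod>j\<in>UNIV. exp (- real (head_sum (p + 1) j) * t $ j))"
        unfolding sum_head_sum_mult[symmetric] by (simp add: exp_sum flip: sum_negf)
      finally show ?thesis by simp
    qed
    show ?thesis
      using True quot unfolding z_def[symmetric] expo
      by (simp add: z_def f_def sum_distrib_left prod.distrib mult_ac)
  qed
  have pos: "0 < real (head_sum (p + 1) j)" for p :: "(nat, 'n) vec" and j
    using head_sum_add_one_pos[of p j] by simp
  have f_int: "integrable lborel (f p j)" for p j
    unfolding f_def by (rule integrable_Gamma_scaled[OF s pos])
  have f_val: "(LINT x|lborel. f p j x) = Gamma (s $ j) / of_nat (head_sum (p + 1) j) powr (s $ j)" for p j
    using integral_Gamma_scaled[OF s pos, of j p j] by (simp add: f_def)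
  have "eta_neg_integral k s = 1 / (\<Prod>j\<in>UNIV. Gamma (s $ j)) *
      integral\<^sup>L lborel (\<lambda>t :: (real, 'n) vec. \<Sum>p\<in>B. of_real (newton_coeff k p) * (\<Prod>j\<in>UNIV. f p j (t $ j)))"
    unfolding eta_neg_integral_def set_lebesgue_integral_def integrand ..
  also have "integral\<^sup>L lborel (\<lambda>t :: (real, 'n) vec. \<Sum>p\<in>B. of_real (newton_coeff k p) * (\<Prod>j\<in>UNIV. f p j (t $ j)))
      = (\<Sum>p\<in>B. of_real (newton_coeff k p) * (\<Prod>j\<in>UNIV. Gamma (s $ j) / of_nat (head_sum (p + 1) j) powr (s $ j)))"
    by (simp add: integrable_lborel_prod_vec[OF f_int] integral_lborel_prod_vec[OF f_int] f_val)
  also have "1 / (\<Prod>j\<in>UNIV. Gamma (s $ j)) * \<dots> = newton_dirichlet k s"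
  proof -
    have "Gamma (s $ j) \<noteq> 0" for j
      using s[of j] by (auto simp: Gamma_eq_zero_iff nonpos_Ints_def)
    then show ?thesis
      by (simp add: newton_dirichlet_def B_def prod_dividef sum_distrib_left)
  qed
  finally show ?thesis .
qed

section \<open>The entire continuation and its uniqueness\<close>

lemma entire_newton_dirichlet:
  fixes k :: "nat^'n::{finite,linorder}"
  shows "entire (newton_dirichlet k)"
  unfolding entire_def
proof
  fix s :: "(complex, 'n) vec"
  define B where "B = {p. \<forall>j. p $ j \<le> tail_sum k j}"
  define a where "a = (\<lambda>(p::(nat, 'n) vec) j. complex_of_real (ln (real (head_sum (p + 1) j))))"
  define L where "L = (\<lambda>p (v::(complex, 'n) vec). - (\<Sum>j\<in>UNIV. v $ j * a p j))"
  have eq: "newton_dirichlet k = (\<lambda>v. \<Sum>p\<in>B. of_real (newton_coeff k p) * exp (L p v))"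
  proof
    fix v :: "(complex, 'n) vec"
    have "of_nat (head_sum (p + 1) j) powr (v $ j) = exp (v $ j * a p j)" for p :: "(nat, 'n) vec" and j
      using head_sum_add_one_pos[of p j] by (simp add: powr_def a_def Ln_of_nat)
    then show "newton_dirichlet k v = (\<Sum>p\<in>B. of_real (newton_coeff k p) * exp (L p v))"
      by (simp add: newton_dirichlet_def B_def L_def exp_minus exp_sum divide_inverse)
  qed
  have L: "bounded_linear (L p)" for p
    unfolding L_def
    by (intro bounded_linear_minus bounded_linear_sum bounded_linear_mult_const bounded_linear_vec_nth)
  have exp: "((\<lambda>v. exp (L p v)) has_derivative (\<lambda>v. exp (L p s) * L p v)) (at s)" for p
    by (rule has_derivative_compose[OF bounded_linear_imp_has_derivative[OF L]])
      (use DERIV_exp[of "L p s"] in \<open>simp add: has_field_derivative_def\<close>)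
  have "(newton_dirichlet k has_derivative (\<lambda>v. \<Sum>p\<in>B. of_real (newton_coeff k p) * (exp (L p s) * L p v))) (at s)"
    unfolding eq by (intro has_derivative_sum has_derivative_mult_right exp)
  moreover have "L p (c *s v) = c * L p v" for c v p
    by (simp add: L_def sum_distrib_left mult_ac)
  ultimately show "\<exists>D. (newton_dirichlet k has_derivative D) (at s) \<and> (\<forall>c v. D (c *s v) = c * D v)"
    by (intro exI[of _ "\<lambda>v. \<Sum>p\<in>B. of_real (newton_coeff k p) * (exp (L p s) * L p v)"])
      (auto simp: sum_distrib_left mult_ac)
qed

text \<open>Along the all-ones direction, complex linearity makes the derivative multiplication by
  the number \<open>D 1\<close>.\<close>

lemma entire_holomorphic_diagonal:
  assumes "entire F"
  shows "(\<lambda>w. F (s + w *s 1)) holomorphic_on A"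
proof (rule holomorphic_on_subset[OF _ subset_UNIV], unfold holomorphic_on_open[OF open_UNIV], intro ballI)
  fix w
  obtain D where D: "(F has_derivative D) (at (s + w *s 1))" and lin: "\<And>c v. D (c *s v) = c * D v"
    using assms unfolding entire_def by metis
  have "bounded_linear (\<lambda>w. w *s (1 :: complex^'a))"
    unfolding linear_conv_bounded_linear[symmetric]
    by (rule linearI) (simp_all add: vec_eq_iff algebra_simps)
  then have "((\<lambda>w. s + w *s 1) has_derivative (\<lambda>w. w *s 1)) (at w)"
    by (auto intro!: derivative_eq_intros bounded_linear_imp_has_derivative)
  from has_derivative_compose[OF this D]
  have "((\<lambda>w. F (s + w *s 1)) has_derivative (\<lambda>w. w * D 1)) (at w)"
    unfolding lin .
  then show "\<exists>f'. ((\<lambda>w. F (s + w *s 1)) has_field_derivative f') (at w)"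
    by (auto simp: has_field_derivative_def mult.commute[of _ "D 1"] intro!: exI[of _ "D 1"])
qed

text \<open>Moving \<open>s\<close> by w in every coordinate brings all real parts above 0 once Re w
  exceeds \<open>R\<close>. The one-variable identity theorem carries the agreement from that
  half-plane back to w = 0.\<close>

lemma entire_eqI:
  fixes F G :: "complex^'n \<Rightarrow> complex"
  assumes "entire F" "entire G"
    and eq: "\<And>s. (\<And>j. 0 < Re (s $ j)) \<Longrightarrow> F s = G s"
  shows "F = G"
proof
  fix s :: "complex^'n"
  define R where "R = (\<Sum>j\<in>UNIV. \<bar>Re (s $ j)\<bar>)"
  have "F (s + 0 *s 1) = G (s + 0 *s 1)"
  proof (rule analytic_continuation_open[of "{w. R < Re w}" UNIV "\<lambda>w. F (s + w *s 1)" "\<lambda>w. G (s + w *s 1)"])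
    fix w assume w: "w \<in> {w. R < Re w}"
    show "F (s + w *s 1) = G (s + w *s 1)"
    proof (rule eq)
      fix j
      have "\<bar>Re (s $ j)\<bar> \<le> R" unfolding R_def by (rule member_le_sum) auto
      then show "0 < Re ((s + w *s 1) $ j)" using w by auto
    qed
  next
    have "complex_of_real (R + 1) \<in> {w. R < Re w}" by simp
    then show "{w. R < Re w} \<noteq> {}" by blast
  qed (use assms in \<open>auto intro: entire_holomorphic_diagonal open_halfspace_Re_gt\<close>)
  then show "F s = G s" by simp
qed

lemma eta_neg_eq_newton_dirichlet: "eta_neg k = newton_dirichlet k"
  unfolding eta_neg_def
proof (rule the_equality)
  show "entire (newton_dirichlet k) \<and> (\<forall>s. (\<forall>j. 0 < Re (s $ j)) \<longrightarrow> newton_dirichlet k s = eta_neg_integral k s)"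
    using entire_newton_dirichlet eta_neg_integral_eq_newton_dirichlet by metis
next
  fix F assume F: "entire F \<and> (\<forall>s. (\<forall>j. 0 < Re (s $ j)) \<longrightarrow> F s = eta_neg_integral k s)"
  show "F = newton_dirichlet k"
    by (rule entire_eqI) (use F in \<open>auto simp: entire_newton_dirichlet eta_neg_integral_eq_newton_dirichlet\<close>)
qed

theorem theorem5p10:
  fixes k :: "nat ^ 'n::{finite,linorder}" and s :: "complex ^ 'n::{finite,linorder}"
  shows "eta_neg k s = mpb s k"
  by (simp add: eta_neg_eq_newton_dirichlet mpb_eq_newton_dirichlet)

end
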